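(* The set of $x\in[0,1]\setminus\mathbb{Q}$ which are continued fraction normal is a $\mathbf{\Pi}^0_3$-complete set.
   Context: Let $T\colon[0,1]\setminus\mathbb{Q}\to[0,1]\setminus\mathbb{Q}$, $T(x)=\frac1x-\lfloor\frac1x\rfloor$, be the continued fraction map, and let $\mu(A)=\frac1{\ln 2}\int_0^1\frac{\chi_A(x)}{1+x}\,dx$ be the Gauss measure, which is $T$-invariant and ergodic. A point $x\in[0,1]\setminus\mathbb{Q}$ is continued fraction normal if it generates the Gauss measure, i.e. $\lim_{N\to\infty}\frac1N|\{0\le n<N: T^n(x)\in I\}|=\mu(I)$ for every interval $I\subseteq[0,1]$. In the Polish space $[0,1]\setminus\mathbb{Q}$: $\mathbf{\Sigma}^0_1$ = open sets, $\mathbf{\Pi}^0_k$ = complements of $\mathbf{\Sigma}^0_k$ sets, $\mathbf{\Sigma}^0_{k+1}$ = countable unions of $\mathbf{\Pi}^0_k$ sets. A set is $\mathbf{\Pi}^0_3$-complete if it is in $\mathbf{\Pi}^0_3\setminus\mathbf{\Sigma}^0_3$. *)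

theory Defs
  imports "HOL-Analysis.Analysis"
begin

(* Finite levels of the Borel hierarchy of a topological space. The levels are
   indexed from 1; level 0 is not meaningful, and Sigma0 X 0 is set to be empty. *)
fun Sigma0 :: "'a topology \<Rightarrow> nat \<Rightarrow> 'a set set"
  and Pi0 :: "'a topology \<Rightarrow> nat \<Rightarrow> 'a set set" where
  "Sigma0 X 0 = {}"
| "Sigma0 X (Suc 0) = {U. openin X U}"
| "Sigma0 X (Suc (Suc k)) = {\<Union>\<C> |\<C>. countable \<C> \<and> \<C> \<subseteq> Pi0 X (Suc k)}"
| "Pi0 X k = {topspace X - A |A. A \<in> Sigma0 X k}"

definition Pi0_complete :: "'a topology \<Rightarrow> nat \<Rightarrow> 'a set \<Rightarrow> bool" where
  "Pi0_complete X k A \<longleftrightarrow> A \<in> Pi0 X k \<and> A \<notin> Sigma0 X k"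

definition unit_irrationals :: "real set" where
  "unit_irrationals = {0..1} - \<rat>"

definition gauss_map :: "real \<Rightarrow> real" where
  "gauss_map x = 1 / x - of_int \<lfloor>1 / x\<rfloor>"

lemma gauss_map_closed:
  assumes "x \<in> unit_irrationals"
  shows "gauss_map x \<in> unit_irrationals"
proof -
  have "1 / x \<notin> \<rat>"
  proof
    assume "1 / x \<in> \<rat>"
    from Rats_divide[OF Rats_1 this] have "1 / (1 / x) \<in> \<rat>" .
    then show False using assms by (simp add: unit_irrationals_def)
  qed
  then have "gauss_map x \<notin> \<rat>"
    unfolding gauss_map_def by (metis Rats_add Rats_of_int diff_add_cancel)
  moreover have "gauss_map x \<in> {0..1}"
    unfolding gauss_map_def by (simp; linarith)
  ultimately show ?thesis by (simp add: unit_irrationals_def)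
qed

definition gauss_measure :: "real set \<Rightarrow> real" where
  "gauss_measure A = 1 / ln 2 * (LINT x:{0..1}|lborel. indicator A x / (1 + x))"

(* Intervals of every kind (open, closed, half-open, degenerate) are tested. *)
definition cf_normal :: "real \<Rightarrow> bool" where
  "cf_normal x \<longleftrightarrow>
     (\<forall>I. is_interval I \<and> I \<subseteq> {0..1} \<longrightarrow>
        (\<lambda>N. 1 / real N * real (card {n. n < N \<and> (gauss_map ^^ n) x \<in> I}))
          \<longlonglongrightarrow> gauss_measure I)"

end

theory Submission
  imports Defs "HOL-Real_Asymp.Real_Asymp"
begin

text \<open>
  A point is normal iff its orbit is equidistributed with respect to the distribution function
  \<open>log 2 (1 + t)\<close>; for rational \<open>t\<close> the finite-time frequencies are locally constant on the
  irrationals, which gives the upper bound. For the lower bound, sequences of natural numbers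
  tending to infinity are reduced continuously to normal points: in a normal digit sequence, the
  first \<open>2 ^ m / (\<alpha> m + 1)\<close> digits of the block \<open>[2 ^ m, 2 ^ Suc m)\<close> are replaced by \<open>1\<close>. The result
  is normal iff \<open>\<alpha>\<close> tends to infinity, and the set of such \<open>\<alpha>\<close> is not a countable union of
  \<open>G\<^sub>\<delta>\<close> sets by a Baire category argument.

  A normal digit sequence is obtained without the ergodic theorem. Take an equidistributed sequence
  of points \<open>x\<^sub>0, x\<^sub>1, \<dots>\<close>; by invariance of the Gauss measure, \<open>T\<^sup>i x\<^sub>0, T\<^sup>i x\<^sub>1, \<dots>\<close> is equidistributed
  for every \<open>i\<close>. Hence so is the concatenation of the orbit segments of a fixed length \<open>2 ^ L\<close>, and
  also the concatenation with \<open>L\<close> growing slowly enough. The latter is an orbit up to errors of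
  density zero, and is therefore shadowed by the true orbit of the point whose digits are the first
  digits of the sequence.
\<close>

subsection \<open>Continued fractions\<close>

definition cf_digit :: "real \<Rightarrow> nat" where
  "cf_digit x = nat \<lfloor>1 / x\<rfloor>"

text \<open>The \<open>n\<close>-th convergent \<open>[0; a 0, ..., a (n - 1)]\<close>. Recursion on
  the first digit rather than the last makes dropping that digit a shift of the sequence, which is
  how the Gauss map acts.\<close>

fun cf_approx :: "nat \<Rightarrow> (nat \<Rightarrow> nat) \<Rightarrow> real" where
  "cf_approx 0 a = 0"
| "cf_approx (Suc n) a = 1 / (real (a 0) + cf_approx n (\<lambda>i. a (Suc i)))"

definition cf_value :: "(nat \<Rightarrow> nat) \<Rightarrow> real" where
  "cf_value a = lim (\<lambda>n. cf_approx n a)"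

lemma unit_irrationals_bounds:
  assumes "x \<in> unit_irrationals"
  shows "0 < x" "x < 1"
proof -
  have "x \<noteq> 0" "x \<noteq> 1" "0 \<le> x" "x \<le> 1"
    using assms by (auto simp: unit_irrationals_def)
  then show "0 < x" "x < 1" by linarith+
qed

lemma gauss_map_funpow_closed:
  "x \<in> unit_irrationals \<Longrightarrow> (gauss_map ^^ n) x \<in> unit_irrationals"
  by (induction n) (auto intro: gauss_map_closed)

lemma cf_digit_ge_1:
  assumes "0 < x" "x < 1"
  shows "1 \<le> cf_digit x"
proof -
  have "1 \<le> 1 / x" using assms by (simp add: field_simps)
  then have "1 \<le> \<lfloor>1 / x\<rfloor>" by (subst le_floor_iff) simp
  then show ?thesis unfolding cf_digit_def by linarith
qed

lemma real_cf_digit: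
  "0 < x \<Longrightarrow> real (cf_digit x) = of_int \<lfloor>1 / x\<rfloor>"
  unfolding cf_digit_def by simp

lemma gauss_map_step:
  assumes "0 < x"
  shows "x = 1 / (real (cf_digit x) + gauss_map x)"
  using assms by (simp add: real_cf_digit gauss_map_def)

text \<open>A single step \<open>t -> 1 / (a + t)\<close> has no uniform contraction factor when
  \<open>a = 1\<close> and \<open>t\<close> is near \<open>0\<close>. After two steps the difference
  is \<open>s - t\<close> divided by the product of \<open>a * (b + s) + 1\<close> and
  \<open>a * (b + t) + 1\<close>, both at least \<open>2\<close>.\<close>

lemma two_step_contraction:
  fixes a b s t :: real
  assumes "1 \<le> a" "1 \<le> b" "0 \<le> s" "0 \<le> t"
  shows "\<bar>1 / (a + 1 / (b + s)) - 1 / (a + 1 / (b + t))\<bar> \<le> \<bar>s - t\<bar> / 4"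
proof -
  have *: "2 \<le> a * (b + r) + 1" if "0 \<le> r" for r
    using mult_mono[of 1 a 1 "b + r"] assms that by simp
  have eq: "1 / (a + 1 / (b + r)) = (b + r) / (a * (b + r) + 1)" if "0 \<le> r" for r
    using assms that *[OF that] by (simp add: field_simps)
  have "1 / (a + 1 / (b + s)) - 1 / (a + 1 / (b + t))
      = (s - t) / ((a * (b + s) + 1) * (a * (b + t) + 1))"
    using *[of s] *[of t] assms by (simp add: eq field_simps)
  moreover have "4 \<le> (a * (b + s) + 1) * (a * (b + t) + 1)"
    using mult_mono[OF *[of s] *[of t]] assms *[of s] by simp
  ultimately have "\<bar>1 / (a + 1 / (b + s)) - 1 / (a + 1 / (b + t))\<bar>
      = \<bar>s - t\<bar> / ((a * (b + s) + 1) * (a * (b + t) + 1))"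
    "4 \<le> (a * (b + s) + 1) * (a * (b + t) + 1)"
    by (simp_all only: abs_divide abs_of_nonneg)
  then show ?thesis
    by (simp only:) (intro frac_le; simp)
qed

text \<open>\<open>s\<close> and \<open>t\<close> are the successive tails of two expansions with
  common digits \<open>a\<close>. Only the recursion is assumed, and only for \<open>2 * k\<close>
  indices, so the bound covers convergents, infinite values and stretches of a pseudo-orbit
  alike.\<close>

lemma cf_agree_close:
  fixes s t :: "nat \<Rightarrow> real"
  assumes "\<And>i. i < 2 * k \<Longrightarrow> s i = 1 / (real (a i) + s (Suc i))"
    and "\<And>i. i < 2 * k \<Longrightarrow> t i = 1 / (real (a i) + t (Suc i))"
    and "\<And>i. i < 2 * k \<Longrightarrow> 1 \<le> a i"
    and "\<And>i. i \<le> 2 * k \<Longrightarrow> 0 \<le> s i \<and> s i \<le> 1" "\<And>i. i \<le> 2 * k \<Longrightarrow> 0 \<le> t i \<and> t i \<le> 1"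
  shows "\<bar>s 0 - t 0\<bar> \<le> (1/4) ^ k"
  using assms
proof (induction k arbitrary: s t a)
  case 0
  then show ?case using 0(4)[of 0] 0(5)[of 0] by auto
next
  case (Suc k)
  have IH: "\<bar>s 2 - t 2\<bar> \<le> (1/4) ^ k"
    using Suc.IH[of "\<lambda>i. s (i + 2)" "\<lambda>i. a (i + 2)" "\<lambda>i. t (i + 2)"] Suc.prems
    by (simp add: numeral_2_eq_2)
  have "s 0 = 1 / (real (a 0) + 1 / (real (a 1) + s 2))"
    using Suc.prems(1)[of 0] Suc.prems(1)[of 1] by (simp add: numeral_2_eq_2)
  moreover have "t 0 = 1 / (real (a 0) + 1 / (real (a 1) + t 2))"
    using Suc.prems(2)[of 0] Suc.prems(2)[of 1] by (simp add: numeral_2_eq_2)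
  moreover have "1 \<le> real (a 0)" "1 \<le> real (a 1)"
    using Suc.prems(3)[of 0] Suc.prems(3)[of 1] by auto
  ultimately have "\<bar>s 0 - t 0\<bar> \<le> \<bar>s 2 - t 2\<bar> / 4"
    using two_step_contraction[of "real (a 0)" "real (a 1)" "s 2" "t 2"] Suc.prems(4,5)[of 2]
    by simp
  then show ?case using IH by simp
qed

lemma cf_approx_bounds:
  "(\<And>i. 1 \<le> a i) \<Longrightarrow> 0 \<le> cf_approx n a \<and> cf_approx n a \<le> 1"
proof (induction n arbitrary: a)
  case (Suc n)
  have "0 \<le> cf_approx n (\<lambda>i. a (Suc i))" "1 \<le> real (a 0)"
    using Suc.IH[of "\<lambda>i. a (Suc i)"] Suc.prems by auto
  then show ?case by simp
qed simp

lemma cf_approx_close: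
  assumes "\<And>i. 1 \<le> a i" "2 * k \<le> m" "2 * k \<le> n"
  shows "\<bar>cf_approx m a - cf_approx n a\<bar> \<le> (1/4) ^ k"
proof -
  have *: "cf_approx (p - i) (\<lambda>j. a (j + i))
      = 1 / (real (a i) + cf_approx (p - Suc i) (\<lambda>j. a (j + Suc i)))"
    if "i < 2 * k" "2 * k \<le> p" for p i
    using that by (subst Suc_diff_Suc[symmetric]) simp_all
  have "\<bar>cf_approx (m - 0) (\<lambda>j. a (j + 0)) - cf_approx (n - 0) (\<lambda>j. a (j + 0))\<bar> \<le> (1/4) ^ k"
    by (rule cf_agree_close[where s = "\<lambda>i. cf_approx (m - i) (\<lambda>j. a (j + i))" and a = a
        and t = "\<lambda>i. cf_approx (n - i) (\<lambda>j. a (j + i))"])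
      (rule * cf_approx_bounds assms | assumption)+
  then show ?thesis by simp
qed

lemma cf_approx_LIMSEQ:
  assumes "\<And>i. 1 \<le> a i"
  shows "(\<lambda>n. cf_approx n a) \<longlonglongrightarrow> cf_value a"
proof -
  have "Cauchy (\<lambda>n. cf_approx n a)"
  proof (rule metric_CauchyI)
    fix e :: real assume "0 < e"
    then obtain k where "(1/4::real) ^ k < e"
      using real_arch_pow_inv[of e "1/4"] by auto
    then show "\<exists>M. \<forall>m\<ge>M. \<forall>n\<ge>M. dist (cf_approx m a) (cf_approx n a) < e"
      using cf_approx_close[OF assms] unfolding dist_real_def by (meson le_less_trans)
  qed
  then show ?thesis
    unfolding cf_value_def by (simp add: Cauchy_convergent convergent_LIMSEQ_iff[symmetric])
qed

lemma cf_value_bounds: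
  assumes "\<And>i. 1 \<le> a i"
  shows "0 \<le> cf_value a \<and> cf_value a \<le> 1"
  using cf_approx_bounds[OF assms]
  by (auto intro: LIMSEQ_le_const[OF cf_approx_LIMSEQ[OF assms]]
      LIMSEQ_le_const2[OF cf_approx_LIMSEQ[OF assms]])

lemma cf_value_step:
  assumes "\<And>i. 1 \<le> a i"
  shows "cf_value a = 1 / (real (a 0) + cf_value (\<lambda>i. a (Suc i)))"
proof (rule LIMSEQ_unique)
  show "(\<lambda>n. cf_approx (Suc n) a) \<longlonglongrightarrow> cf_value a"
    using cf_approx_LIMSEQ[OF assms] by (rule LIMSEQ_Suc)
  have "1 \<le> real (a 0)" using assms[of 0] by simp
  then have "real (a 0) + cf_value (\<lambda>i. a (Suc i)) \<noteq> 0"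
    using cf_value_bounds[of "\<lambda>i. a (Suc i)"] assms by force
  then show "(\<lambda>n. cf_approx (Suc n) a) \<longlonglongrightarrow> 1 / (real (a 0) + cf_value (\<lambda>i. a (Suc i)))"
    using assms by (simp, intro tendsto_intros cf_approx_LIMSEQ) auto
qed

lemma cf_value_strict_bounds:
  assumes "\<And>i. 1 \<le> a i"
  shows "0 < cf_value a" "cf_value a < 1"
proof -
  have pos: "0 < cf_value b" if "\<And>i. 1 \<le> b i" for b
  proof -
    have "0 < real (b 0)" using that[of 0] by simp
    moreover have "0 \<le> cf_value (\<lambda>i. b (Suc i))"
      using cf_value_bounds[of "\<lambda>i. b (Suc i)"] that by simp
    ultimately show ?thesis
      by (subst cf_value_step[OF that]) (simp add: add_pos_nonneg)
  qed
  show "0 < cf_value a" by (rule pos) fact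
  show "cf_value a < 1"
  proof -
    have "1 \<le> real (a 0)" using assms[of 0] by simp
    moreover have "0 < cf_value (\<lambda>i. a (Suc i))"
      using pos[of "\<lambda>i. a (Suc i)"] assms by simp
    ultimately show ?thesis
      by (subst cf_value_step[OF assms]) simp
  qed
qed

text \<open>\<open>1 / cf_value a\<close> is \<open>a 0\<close> plus a tail strictly between
  \<open>0\<close> and \<open>1\<close>, so floor and fractional part separate the two.\<close>

lemma cf_digit_cf_value:
  assumes "\<And>i. 1 \<le> a i"
  shows "cf_digit (cf_value a) = a 0"
    and "gauss_map (cf_value a) = cf_value (\<lambda>i. a (Suc i))"
proof -
  define v where "v = cf_value (\<lambda>i. a (Suc i))"
  have v: "0 < v" "v < 1"
    unfolding v_def by (rule cf_value_strict_bounds, rule assms)+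
  have eq: "1 / cf_value a = real (a 0) + v"
    unfolding v_def by (subst cf_value_step[OF assms]) (simp_all only: divide_divide_eq_right mult_1 div_by_1)
  have fl: "\<lfloor>1 / cf_value a\<rfloor> = int (a 0)"
    unfolding eq using v by (intro floor_unique) auto
  show "cf_digit (cf_value a) = a 0" unfolding cf_digit_def fl by simp
  show "gauss_map (cf_value a) = cf_value (\<lambda>i. a (Suc i))"
    unfolding gauss_map_def fl unfolding eq by (simp add: v_def)
qed

lemma gauss_map_funpow_cf_value:
  "(\<And>i. 1 \<le> a i) \<Longrightarrow> (gauss_map ^^ n) (cf_value a) = cf_value (\<lambda>i. a (i + n))"
  by (induction n) (simp_all add: cf_digit_cf_value)

text \<open>On rationals the Gauss map is the Euclidean algorithm.\<close>

lemma gauss_map_rational_terminates: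
  assumes "0 < p" "0 < q"
  shows "\<exists>n. (gauss_map ^^ n) (real p / real q) = 0"
  using assms
proof (induction p arbitrary: q rule: less_induct)
  case (less p)
  have "gauss_map (real p / real q) = real (q mod p) / real p"
  proof -
    have "\<lfloor>real q / real p\<rfloor> = int (q div p)"
      by (rule floor_divide_of_nat_eq)
    moreover have "real q = real (q div p) * real p + real (q mod p)"
      by (metis div_mult_mod_eq of_nat_add of_nat_mult)
    ultimately show ?thesis
      using less.prems unfolding gauss_map_def by (simp add: field_simps)
  qed
  then have step: "(gauss_map ^^ Suc n) (real p / real q) = (gauss_map ^^ n) (real (q mod p) / real p)" for n
    by (simp only: funpow_Suc_right o_apply)
  show ?case
  proof (cases "q mod p = 0")
    case True
    then show ?thesis using step[of 0] by (intro exI[of _ 1]) simp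
  next
    case False
    then obtain n where "(gauss_map ^^ n) (real (q mod p) / real p) = 0"
      using less.IH[of "q mod p" p] less.prems by auto
    then show ?thesis using step by metis
  qed
qed

text \<open>The orbit of a rational reaches \<open>0\<close>, whereas every iterate of
  \<open>cf_value a\<close> is the value of a shifted sequence and hence positive.\<close>

lemma cf_value_in_unit_irrationals:
  assumes "\<And>i. 1 \<le> a i"
  shows "cf_value a \<in> unit_irrationals"
proof -
  have b: "0 < cf_value a" "cf_value a < 1"
    using cf_value_strict_bounds assms by auto
  have "cf_value a \<notin> \<rat>"
  proof
    assume "cf_value a \<in> \<rat>"
    then obtain m n :: nat where "n \<noteq> 0" "\<bar>cf_value a\<bar> = real m / real n"
      by (rule Rats_abs_nat_div_natE)
    then have eq: "cf_value a = real m / real n" "0 < n"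
      using b(1) by auto
    then have "0 < m"
      using b by (intro gr0I) simp
    obtain k where "(gauss_map ^^ k) (cf_value a) = 0"
      using gauss_map_rational_terminates[OF \<open>0 < m\<close> \<open>0 < n\<close>] unfolding eq(1) by blast
    then show False
      using gauss_map_funpow_cf_value[of a k] cf_value_strict_bounds[of "\<lambda>i. a (i + k)"] assms
      by simp
  qed
  then show ?thesis using b by (simp add: unit_irrationals_def)
qed

lemma cf_value_close:
  assumes "\<And>i. 1 \<le> a i" "\<And>i. 1 \<le> b i" "\<And>i. i < 2 * k \<Longrightarrow> a i = b i"
  shows "\<bar>cf_value a - cf_value b\<bar> \<le> (1/4) ^ k"
proof -
  have step: "cf_value (\<lambda>j. c (j + i)) = 1 / (real (c i) + cf_value (\<lambda>j. c (j + Suc i)))"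
    if "\<And>i. 1 \<le> c i" for c :: "nat \<Rightarrow> nat" and i
    using cf_value_step[of "\<lambda>j. c (j + i)"] that by simp
  have "\<bar>cf_value (\<lambda>j. a (j + 0)) - cf_value (\<lambda>j. b (j + 0))\<bar> \<le> (1/4) ^ k"
  proof (rule cf_agree_close[where s = "\<lambda>i. cf_value (\<lambda>j. a (j + i))" and a = a
        and t = "\<lambda>i. cf_value (\<lambda>j. b (j + i))"])
    show "cf_value (\<lambda>j. b (j + i)) = 1 / (real (a i) + cf_value (\<lambda>j. b (j + Suc i)))"
      if "i < 2 * k" for i
      unfolding assms(3)[OF that] by (rule step) (rule assms)
  qed (rule step cf_value_bounds assms)+
  then show ?thesis by simp
qed

subsection \<open>Frequencies and sets of density zero\<close>

text \<open>A sandwich rule whose bounds may depend on \<open>e\<close> and need only have limits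
  within \<open>e\<close> of \<open>l\<close>; no single pair of bounds converging to
  \<open>l\<close> is required.\<close>

lemma tendsto_squeeze_approx:
  fixes f :: "nat \<Rightarrow> real"
  assumes "\<And>e. 0 < e \<Longrightarrow> \<exists>g h a b. (g \<longlonglongrightarrow> a) \<and> (h \<longlonglongrightarrow> b) \<and> l - e < a \<and> b < l + e \<and>
      (\<forall>\<^sub>F n in sequentially. g n \<le> f n \<and> f n \<le> h n)"
  shows "f \<longlonglongrightarrow> l"
proof (rule tendstoI)
  fix e :: real assume "0 < e"
  then obtain g h a b where gh: "g \<longlonglongrightarrow> a" "h \<longlonglongrightarrow> b" "l - e < a" "b < l + e"
      "\<forall>\<^sub>F n in sequentially. g n \<le> f n \<and> f n \<le> h n"
    using assms by blast
  have "\<forall>\<^sub>F n in sequentially. l - e < g n" "\<forall>\<^sub>F n in sequentially. h n < l + e"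
    using order_tendstoD gh by blast+
  with gh(5) show "\<forall>\<^sub>F n in sequentially. dist (f n) l < e"
    by eventually_elim (simp add: dist_real_def abs_less_iff)
qed

definition freq :: "(nat \<Rightarrow> bool) \<Rightarrow> nat \<Rightarrow> real" where
  "freq P N = (\<Sum>n<N. of_bool (P n)) / real N"

lemma freq_eq_card: "freq P N = 1 / real N * real (card {n. n < N \<and> P n})"
proof -
  have "{..<N} \<inter> {n. P n} = {n. n < N \<and> P n}" by auto
  then show ?thesis by (simp add: freq_def)
qed

lemma freq_nonneg: "0 \<le> freq P N"
  unfolding freq_def by (intro divide_nonneg_nonneg sum_nonneg) auto

lemma freq_mono: "(\<And>n. n < N \<Longrightarrow> P n \<Longrightarrow> Q n) \<Longrightarrow> freq P N \<le> freq Q N"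
  unfolding freq_def by (intro divide_right_mono sum_mono) auto

lemma freq_not: "0 < N \<Longrightarrow> freq (\<lambda>n. \<not> P n) N = 1 - freq P N"
  unfolding freq_def by (simp add: of_bool_not_iff sum_subtractf diff_divide_distrib)

lemma freq_disj: "freq (\<lambda>n. P n \<or> Q n) N \<le> freq P N + freq Q N"
  unfolding freq_def add_divide_distrib[symmetric] sum.distrib[symmetric]
  by (intro divide_right_mono sum_mono) auto

lemma freq_diff:
  "(\<And>n. P n \<Longrightarrow> Q n) \<Longrightarrow> freq (\<lambda>n. Q n \<and> \<not> P n) N = freq Q N - freq P N"
  unfolding freq_def diff_divide_distrib[symmetric] sum_subtractf[symmetric]
  by (intro arg_cong2[where f = "(/)"] sum.cong) auto

text \<open>The events \<open>P k\<close> are mutually exclusive, so at each time at most one of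
  them contributes.\<close>

lemma sum_freq_le:
  assumes "finite A" "\<And>k n. k \<in> A \<Longrightarrow> P k n \<Longrightarrow> Q n"
    and "\<And>k l n. k \<in> A \<Longrightarrow> l \<in> A \<Longrightarrow> P k n \<Longrightarrow> P l n \<Longrightarrow> k = l"
  shows "(\<Sum>k\<in>A. freq (P k) N) \<le> freq Q N"
proof -
  have "(\<Sum>k\<in>A. of_bool (P k n)) \<le> (of_bool (Q n) :: real)" for n
  proof (cases "\<exists>k\<in>A. P k n")
    case True
    then obtain k where k: "k \<in> A" "P k n" by auto
    have "(\<Sum>l\<in>A. of_bool (P l n)) = (\<Sum>l\<in>A. if l = k then 1 else 0 :: real)"
      using k assms(3) by (intro sum.cong) auto
    then show ?thesis using k assms(1,2) by simp
  next
    case False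
    then have "(\<Sum>k\<in>A. of_bool (P k n)) = (0::real)" by (intro sum.neutral) auto
    then show ?thesis by simp
  qed
  then have "(\<Sum>n<N. \<Sum>k\<in>A. of_bool (P k n)) \<le> (\<Sum>n<N. of_bool (Q n) :: real)"
    by (intro sum_mono)
  then show ?thesis
    unfolding freq_def sum_divide_distrib[symmetric] sum.swap[of _ A]
    by (intro divide_right_mono) auto
qed

definition zero_density :: "(nat \<Rightarrow> bool) \<Rightarrow> bool" where
  "zero_density P \<longleftrightarrow> freq P \<longlonglongrightarrow> 0"

lemma zero_density_mono:
  assumes "zero_density Q" "\<And>n. P n \<Longrightarrow> Q n"
  shows "zero_density P"
  unfolding zero_density_def
  by (rule tendsto_sandwich[OF _ _ tendsto_const assms(1)[unfolded zero_density_def]])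
    (auto intro!: always_eventually freq_nonneg freq_mono assms(2))

lemma zero_density_disj:
  assumes "zero_density P" "zero_density Q"
  shows "zero_density (\<lambda>n. P n \<or> Q n)"
  unfolding zero_density_def
proof (rule tendsto_sandwich[OF _ _ tendsto_const])
  show "(\<lambda>N. freq P N + freq Q N) \<longlonglongrightarrow> 0"
    using tendsto_add[OF assms[unfolded zero_density_def]] by simp
qed (auto intro!: always_eventually freq_nonneg freq_disj)

lemma zero_density_bounded:
  assumes "\<And>n. P n \<Longrightarrow> n < k"
  shows "zero_density P"
  unfolding zero_density_def
proof (rule tendsto_sandwich[OF _ _ tendsto_const])
  show "(\<lambda>N. real k / real N) \<longlonglongrightarrow> 0" by (rule lim_const_over_n)
  have "card {n. n < N \<and> P n} \<le> k" for N
    using card_mono[of "{..<k}" "{n. n < N \<and> P n}"] assms by auto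
  then show "\<forall>\<^sub>F N in sequentially. freq P N \<le> real k / real N"
    by (intro always_eventually allI) (simp add: freq_eq_card divide_right_mono)
qed (auto intro!: always_eventually freq_nonneg)

lemma zero_density_shift:
  assumes "zero_density P"
  shows "zero_density (\<lambda>n. P (n + k))"
proof (induction k)
  case (Suc k)
  have le: "freq (\<lambda>n. P (n + Suc k)) N \<le> freq (\<lambda>n. P (n + k)) N + 1 / real N" for N
  proof -
    have "(\<Sum>n<N. of_bool (P (Suc n + k))) \<le> (\<Sum>n<Suc N. of_bool (P (n + k)) :: real)"
      unfolding sum.lessThan_Suc_shift by simp
    also have "\<dots> \<le> (\<Sum>n<N. of_bool (P (n + k))) + 1" by simp
    finally show ?thesis
      unfolding freq_def add_divide_distrib[symmetric] by (intro divide_right_mono) auto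
  qed
  have lim: "(\<lambda>N. freq (\<lambda>n. P (n + k)) N + 1 / real N) \<longlonglongrightarrow> 0"
    using tendsto_add[OF Suc[unfolded zero_density_def] lim_const_over_n[of 1]] by simp
  show ?case
    unfolding zero_density_def
  proof (rule tendsto_sandwich[OF _ _ tendsto_const lim])
    show "\<forall>\<^sub>F N in sequentially. 0 \<le> freq (\<lambda>n. P (n + Suc k)) N"
      by (intro always_eventually allI freq_nonneg)
    show "\<forall>\<^sub>F N in sequentially. freq (\<lambda>n. P (n + Suc k)) N \<le> freq (\<lambda>n. P (n + k)) N + 1 / real N"
      by (intro always_eventually allI le)
  qed
qed (use assms in simp)

lemma zero_density_ex_shift:
  assumes "zero_density P"
  shows "zero_density (\<lambda>n. \<exists>k<m. P (n + k))"
proof (induction m)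
  case (Suc m)
  show ?case
    by (rule zero_density_mono[OF zero_density_disj[OF Suc zero_density_shift[OF assms, of m]]])
      (auto simp: less_Suc_eq)
qed (simp add: zero_density_def freq_def[abs_def])

text \<open>Each residue class modulo \<open>m\<close> takes up a proportion \<open>1 / m\<close> of
  the time, so the overall frequency tends to the average of the frequencies along the
  classes.\<close>

lemma freq_interleave:
  assumes "0 < m" "\<And>i. i < m \<Longrightarrow> freq (\<lambda>j. P (j * m + i)) \<longlonglongrightarrow> l i"
  shows "freq P \<longlonglongrightarrow> (\<Sum>i<m. l i) / real m"
proof -
  \<comment> \<open>The number of \<open>n < N\<close> congruent to \<open>i\<close> modulo
    \<open>m\<close>; the summand \<open>m - 1 - i\<close> rounds \<open>(N - i) / m\<close> up, and
    gives \<open>0\<close> when \<open>N \<le> i\<close>.\<close>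
  define J where "J i N = (N + (m - 1 - i)) div m" for i N
  have J: "j * m + i < N \<longleftrightarrow> j < J i N" if "i < m" for i j N
  proof -
    have "j < J i N \<longleftrightarrow> Suc j * m \<le> N + (m - 1 - i)"
      unfolding J_def using assms(1) by (simp add: less_eq_div_iff_mult_less_eq Suc_le_eq[symmetric] del: mult_Suc)
    then show ?thesis using that by auto
  qed
  have count: "(\<Sum>n<N. of_bool (P n)) = (\<Sum>i<m. \<Sum>j<J i N. of_bool (P (j * m + i)) :: real)" for N
  proof -
    have "(\<Sum>i<m. \<Sum>j<J i N. of_bool (P (j * m + i)) :: real)
        = (\<Sum>(i, j)\<in>(SIGMA i:{..<m}. {..<J i N}). of_bool (P (j * m + i)))"
      by (rule sum.Sigma) auto
    also have "\<dots> = (\<Sum>n<N. of_bool (P n))"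
      by (rule sum.reindex_bij_witness[where i = "\<lambda>n. (n mod m, n div m)" and j = "\<lambda>(i, j). j * m + i"])
        (use assms(1) J in \<open>auto simp: J[symmetric]\<close>)
    finally show ?thesis by simp
  qed
  have J_lim: "(\<lambda>N. real (J i N) / real N) \<longlonglongrightarrow> 1 / real m" if "i < m" for i
  proof (rule tendsto_sandwich)
    show "(\<lambda>N. 1 / real m - 1 / real N) \<longlonglongrightarrow> 1 / real m"
      "(\<lambda>N. 1 / real m + 1 / real N) \<longlonglongrightarrow> 1 / real m"
      using tendsto_diff[OF tendsto_const lim_const_over_n[of 1]]
        tendsto_add[OF tendsto_const lim_const_over_n[of 1]] by simp_all
    have *: "real N / real m - 1 \<le> real (J i N)" "real (J i N) \<le> real N / real m + 1" for N
    proof -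
      have "real N < real m * real (J i N + 1)" "real m * real (J i N) \<le> real (N + m)"
        unfolding of_nat_mult[symmetric] J_def of_nat_le_iff of_nat_less_iff
        using assms(1) dividend_less_times_div[of m "N + (m - 1 - i)"]
          order_trans[OF times_div_less_eq_dividend[of m "N + (m - 1 - i)"], of "N + m"]
        by auto
      then show "real N / real m - 1 \<le> real (J i N)" "real (J i N) \<le> real N / real m + 1"
        using assms(1) by (auto simp: field_simps)
    qed
    have **: "1 / real m - 1 / real N \<le> real (J i N) / real N \<and> real (J i N) / real N \<le> 1 / real m + 1 / real N"
      if "0 < N" for N
      using divide_right_mono[OF *(1)[of N], of "real N"] divide_right_mono[OF *(2)[of N], of "real N"] that
      by (simp add: diff_divide_distrib add_divide_distrib)
    show "\<forall>\<^sub>F N in sequentially. 1 / real m - 1 / real N \<le> real (J i N) / real N"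
      "\<forall>\<^sub>F N in sequentially. real (J i N) / real N \<le> 1 / real m + 1 / real N"
      using eventually_gt_at_top[of 0] by (eventually_elim; use ** in blast)+
  qed
  have J_top: "filterlim (J i) at_top sequentially" if "i < m" for i
    unfolding filterlim_at_top
  proof
    fix Z
    show "\<forall>\<^sub>F N in sequentially. Z \<le> J i N"
      using eventually_ge_at_top[of "Z * m"]
    proof eventually_elim
      case (elim N)
      have "Z * m \<le> N + (m - 1 - i)" using elim by simp
      then show ?case unfolding J_def using assms(1) by (simp add: less_eq_div_iff_mult_less_eq)
    qed
  qed
  have "(\<lambda>N. \<Sum>i<m. freq (\<lambda>j. P (j * m + i)) (J i N) * (real (J i N) / real N))
      \<longlonglongrightarrow> (\<Sum>i<m. l i * (1 / real m))"
    by (intro tendsto_sum tendsto_mult J_lim filterlim_compose[OF assms(2) J_top]) auto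
  moreover have "freq (\<lambda>j. P (j * m + i)) (J i N) * (real (J i N) / real N)
      = (\<Sum>j<J i N. of_bool (P (j * m + i))) / real N" for i N
    \<comment> \<open>For \<open>J i N = 0\<close> both sides vanish, since \<open>freq\<close> at
      \<open>0\<close> is a quotient by zero and hence \<open>0\<close>.\<close>
    by (cases "J i N = 0") (simp_all add: freq_def)
  moreover have "freq P = (\<lambda>N. \<Sum>i<m. (\<Sum>j<J i N. of_bool (P (j * m + i))) / real N)"
    unfolding sum_divide_distrib[symmetric] count[symmetric] freq_def[abs_def] ..
  ultimately show ?thesis
    by (simp only: sum_divide_distrib times_divide_eq_right mult_1_right)
qed

subsection \<open>Equidistribution for the Gauss measure\<close>

text \<open>The distribution function of the Gauss measure. Clamping the argument makes the formula
  correct for every real \<open>t\<close>.\<close>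

definition gauss_cdf :: "real \<Rightarrow> real" where
  "gauss_cdf t = log 2 (1 + max 0 (min 1 t))"

lemma gauss_cdf_eq:
  "t \<le> 0 \<Longrightarrow> gauss_cdf t = 0" "1 \<le> t \<Longrightarrow> gauss_cdf t = 1"
  "0 \<le> t \<Longrightarrow> t \<le> 1 \<Longrightarrow> gauss_cdf t = ln (1 + t) / ln 2"
  by (auto simp: gauss_cdf_def log_def)

lemma gauss_cdf_bounds: "0 \<le> gauss_cdf t" "gauss_cdf t \<le> 1"
  by (auto simp: gauss_cdf_def)

lemma isCont_gauss_cdf: "isCont gauss_cdf t"
  unfolding gauss_cdf_def[abs_def] log_def by (intro continuous_intros) auto

lemma gauss_cdf_near:
  assumes "0 < e"
  obtains d where "0 < d" "gauss_cdf (t + d) < gauss_cdf t + e" "gauss_cdf t - e < gauss_cdf (t - d)"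
proof -
  obtain d where d: "0 < d" "\<And>s. \<bar>s - t\<bar> < d \<Longrightarrow> \<bar>gauss_cdf s - gauss_cdf t\<bar> < e"
    using isCont_gauss_cdf[of t] assms unfolding continuous_at_real_range by (auto simp: abs_minus_commute)
  have "\<bar>gauss_cdf (t + d/2) - gauss_cdf t\<bar> < e" "\<bar>gauss_cdf (t - d/2) - gauss_cdf t\<bar> < e"
    using d by (intro d(2); simp)+
  then show thesis
    using d(1) by (intro that[of "d/2"]) auto
qed

text \<open>Testing open half-lines is enough: \<open>gauss_cdf\<close> is continuous, so endpoints
  carry no mass and all other intervals follow by differences.\<close>

definition gauss_distributed :: "(nat \<Rightarrow> real) \<Rightarrow> bool" where
  "gauss_distributed z \<longleftrightarrow> (\<forall>q. freq (\<lambda>n. z n < q) \<longlonglongrightarrow> gauss_cdf q)"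

lemma gauss_distributedD:
  "gauss_distributed z \<Longrightarrow> freq (\<lambda>n. z n < q) \<longlonglongrightarrow> gauss_cdf q"
  by (simp add: gauss_distributed_def)

text \<open>Outside a set of density zero, \<open>z n < q - d\<close> implies
  \<open>z' n < q\<close>, which implies \<open>z n < q + d\<close>; continuity of
  \<open>gauss_cdf\<close> makes the outer limits as close as desired.\<close>

lemma gauss_distributed_perturb:
  assumes "gauss_distributed z" "\<And>e. 0 < e \<Longrightarrow> zero_density (\<lambda>n. e \<le> \<bar>z' n - z n\<bar>)"
  shows "gauss_distributed z'"
  unfolding gauss_distributed_def
proof (intro allI tendsto_squeeze_approx)
  fix q e :: real assume "0 < e"
  then obtain d where d: "0 < d" "gauss_cdf (q + d) < gauss_cdf q + e"
      "gauss_cdf q - e < gauss_cdf (q - d)"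
    by (rule gauss_cdf_near)
  let ?B = "\<lambda>n. d \<le> \<bar>z' n - z n\<bar>"
  have B: "freq ?B \<longlonglongrightarrow> 0"
    using assms(2)[OF d(1)] by (simp add: zero_density_def)
  have "(\<lambda>N. freq (\<lambda>n. z n < q - d) N - freq ?B N) \<longlonglongrightarrow> gauss_cdf (q - d) - 0"
    "(\<lambda>N. freq (\<lambda>n. z n < q + d) N + freq ?B N) \<longlonglongrightarrow> gauss_cdf (q + d) + 0"
    by (intro tendsto_intros B gauss_distributedD assms(1))+
  moreover have "freq (\<lambda>n. z n < q - d) N - freq ?B N \<le> freq (\<lambda>n. z' n < q) N" for N
  proof -
    have "freq (\<lambda>n. z n < q - d) N \<le> freq (\<lambda>n. z' n < q \<or> ?B n) N"
      by (rule freq_mono) auto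
    then show ?thesis using freq_disj[of "\<lambda>n. z' n < q" ?B N] by simp
  qed
  moreover have "freq (\<lambda>n. z' n < q) N \<le> freq (\<lambda>n. z n < q + d) N + freq ?B N" for N
  proof -
    have "freq (\<lambda>n. z' n < q) N \<le> freq (\<lambda>n. z n < q + d \<or> ?B n) N"
      by (rule freq_mono) auto
    then show ?thesis using freq_disj[of "\<lambda>n. z n < q + d" ?B N] by simp
  qed
  ultimately show "\<exists>g h a b. (g \<longlonglongrightarrow> a) \<and> (h \<longlonglongrightarrow> b) \<and> gauss_cdf q - e < a \<and> b < gauss_cdf q + e \<and>
      (\<forall>\<^sub>F N in sequentially. g N \<le> freq (\<lambda>n. z' n < q) N \<and> freq (\<lambda>n. z' n < q) N \<le> h N)"
    using d(2,3) by (intro exI conjI always_eventually allI) auto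
qed

text \<open>Frequencies are monotone in the threshold and \<open>gauss_cdf\<close> is continuous, so
  rational thresholds decide. This countable family is needed both for the diagonal argument and for
  the Borel upper bound.\<close>

lemma gauss_distributed_dense:
  assumes "\<And>q. freq (\<lambda>n. z n < real_of_rat q) \<longlonglongrightarrow> gauss_cdf (real_of_rat q)"
  shows "gauss_distributed z"
  unfolding gauss_distributed_def
proof (intro allI tendsto_squeeze_approx)
  fix q e :: real assume "0 < e"
  then obtain d where d: "0 < d" "gauss_cdf (q + d) < gauss_cdf q + e"
      "gauss_cdf q - e < gauss_cdf (q - d)"
    by (rule gauss_cdf_near)
  obtain r s where rs: "q - d < real_of_rat r" "real_of_rat r < q" "q < real_of_rat s" "real_of_rat s < q + d"
    using of_rat_dense[of "q - d" q] of_rat_dense[of q "q + d"] d(1) by auto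
  have mono: "gauss_cdf a \<le> gauss_cdf b" if "a \<le> b" for a b
    unfolding gauss_cdf_def using that by (subst log_le_cancel_iff) auto
  have "gauss_cdf q - e < gauss_cdf (real_of_rat r)" "gauss_cdf (real_of_rat s) < gauss_cdf q + e"
    using mono[of "q - d" "real_of_rat r"] mono[of "real_of_rat s" "q + d"] rs d by linarith+
  moreover have "freq (\<lambda>n. z n < real_of_rat r) N \<le> freq (\<lambda>n. z n < q) N"
      "freq (\<lambda>n. z n < q) N \<le> freq (\<lambda>n. z n < real_of_rat s) N" for N
    using rs by (auto intro!: freq_mono)
  ultimately show "\<exists>g h a b. (g \<longlonglongrightarrow> a) \<and> (h \<longlonglongrightarrow> b) \<and> gauss_cdf q - e < a \<and> b < gauss_cdf q + e \<and>
      (\<forall>\<^sub>F N in sequentially. g N \<le> freq (\<lambda>n. z n < q) N \<and> freq (\<lambda>n. z n < q) N \<le> h N)"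
    using assms[of r] assms[of s] by (intro exI conjI always_eventually allI) auto
qed

lemma gauss_distributed_le:
  assumes "gauss_distributed z"
  shows "freq (\<lambda>n. z n \<le> q) \<longlonglongrightarrow> gauss_cdf q"
proof (rule tendsto_squeeze_approx)
  fix e :: real assume "0 < e"
  then obtain d where d: "0 < d" "gauss_cdf (q + d) < gauss_cdf q + e"
      "gauss_cdf q - e < gauss_cdf (q - d)"
    by (rule gauss_cdf_near)
  have "freq (\<lambda>n. z n < q) N \<le> freq (\<lambda>n. z n \<le> q) N"
      "freq (\<lambda>n. z n \<le> q) N \<le> freq (\<lambda>n. z n < q + d) N" for N
    using d by (auto intro!: freq_mono)
  then show "\<exists>g h a b. (g \<longlonglongrightarrow> a) \<and> (h \<longlonglongrightarrow> b) \<and> gauss_cdf q - e < a \<and> b < gauss_cdf q + e \<and>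
      (\<forall>\<^sub>F N in sequentially. g N \<le> freq (\<lambda>n. z n \<le> q) N \<and> freq (\<lambda>n. z n \<le> q) N \<le> h N)"
    using gauss_distributedD[OF assms, of q] gauss_distributedD[OF assms, of "q + d"] d \<open>0 < e\<close>
    by (intro exI[of _ "freq (\<lambda>n. z n < q)"] exI[of _ "freq (\<lambda>n. z n < q + d)"]
        exI[of _ "gauss_cdf q"] exI[of _ "gauss_cdf (q + d)"] conjI always_eventually allI) auto
qed

lemma gauss_distributed_between:
  assumes "gauss_distributed z" "a \<le> b"
  shows "freq (\<lambda>n. a < z n \<and> z n < b) \<longlonglongrightarrow> gauss_cdf b - gauss_cdf a"
    and "freq (\<lambda>n. a \<le> z n \<and> z n \<le> b) \<longlonglongrightarrow> gauss_cdf b - gauss_cdf a"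
proof -
  show "freq (\<lambda>n. a \<le> z n \<and> z n \<le> b) \<longlonglongrightarrow> gauss_cdf b - gauss_cdf a"
  proof -
    have "freq (\<lambda>n. a \<le> z n \<and> z n \<le> b) = (\<lambda>N. freq (\<lambda>n. z n \<le> b) N - freq (\<lambda>n. z n < a) N)"
      using freq_diff[of "\<lambda>n. z n < a" "\<lambda>n. z n \<le> b"] assms(2)
      by (auto simp: not_less conj_commute)
    then show ?thesis
      using tendsto_diff[OF gauss_distributed_le[OF assms(1)] gauss_distributedD[OF assms(1)]] by simp
  qed
  show "freq (\<lambda>n. a < z n \<and> z n < b) \<longlonglongrightarrow> gauss_cdf b - gauss_cdf a"
  proof (cases "a = b")
    case True
    then have "freq (\<lambda>n. a < z n \<and> z n < b) = (\<lambda>N. 0)" by (auto simp: freq_def fun_eq_iff)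
    then show ?thesis using True by simp
  next
    case False
    then have "freq (\<lambda>n. a < z n \<and> z n < b) = (\<lambda>N. freq (\<lambda>n. z n < b) N - freq (\<lambda>n. z n \<le> a) N)"
      using freq_diff[of "\<lambda>n. z n \<le> a" "\<lambda>n. z n < b"] assms(2)
      by (auto simp: not_le conj_commute)
    then show ?thesis
      using tendsto_diff[OF gauss_distributedD[OF assms(1)] gauss_distributed_le[OF assms(1)]] by simp
  qed
qed

section \<open>Invariance of the Gauss measure under the Gauss map\<close>

lemma floor_inverse_eq:
  fixes k :: nat and z :: real
  assumes "1 \<le> k" "0 < z"
  shows "\<lfloor>1 / z\<rfloor> = int k \<longleftrightarrow> 1 / (real k + 1) < z \<and> z \<le> 1 / real k"
proof -
  have "\<lfloor>1 / z\<rfloor> = int k \<longleftrightarrow> real k \<le> 1 / z \<and> 1 / z < real k + 1"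
    by (simp add: floor_eq_iff)
  then show ?thesis using assms by (auto simp: field_simps)
qed

lemma sum_ln_telescope:
  fixes c :: real
  assumes "0 \<le> c"
  shows "(\<Sum>k=1..K. ln ((real k + 1 + c) / (real k + c))) = ln ((real K + 1 + c) / (1 + c))"
proof (induction K)
  case (Suc K)
  then show ?case using assms
    by (simp add: ln_div add_ac)
qed (use assms in simp)

lemma gauss_cdf_inverse:
  fixes k :: nat and c :: real
  assumes "1 \<le> k" "0 \<le> c"
  shows "gauss_cdf (1 / (real k + c)) = ln ((real k + 1 + c) / (real k + c)) / ln 2"
proof -
  have "1 \<le> real k" using assms by simp
  then have "1 + 1 / (real k + c) = (real k + 1 + c) / (real k + c)" "1 / (real k + c) \<le> 1"
    using assms by (simp_all add: field_simps)
  then show ?thesis using assms by (simp add: gauss_cdf_eq)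
qed

text \<open>For \<open>0 \<le> c \<le> d \<le> 1\<close> the summand is the Gauss measure of the
  points with first digit \<open>k\<close> whose image under the Gauss map lies between
  \<open>c\<close> and \<open>d\<close>. The logarithms telescope, and the limit is the measure of
  the interval from \<open>c\<close> to \<open>d\<close>.\<close>

lemma sum_gauss_cdf_inverse:
  assumes "0 \<le> c" "0 \<le> d"
  shows "(\<lambda>K. \<Sum>k=1..K. gauss_cdf (1 / (real k + c)) - gauss_cdf (1 / (real k + d)))
    \<longlonglongrightarrow> (ln (1 + d) - ln (1 + c)) / ln 2"
proof -
  have "(\<lambda>K. (ln ((real K + 1 + c) / (1 + c)) - ln ((real K + 1 + d) / (1 + d))) / ln 2)
      \<longlonglongrightarrow> (ln (1 + d) - ln (1 + c)) / ln 2"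
  proof -
    have "(\<lambda>K. ln ((real K + 1 + c) / (real K + 1 + d))) \<longlonglongrightarrow> 0"
      by real_asymp
    moreover have "(ln ((real K + 1 + c) / (1 + c)) - ln ((real K + 1 + d) / (1 + d)))
        = ln ((real K + 1 + c) / (real K + 1 + d)) + (ln (1 + d) - ln (1 + c))" for K
      using assms by (simp add: ln_div)
    ultimately show ?thesis
      using tendsto_divide[OF tendsto_add[OF _ tendsto_const] tendsto_const, of _ 0 _ "ln 2 :: real"] by simp
  qed
  moreover have "(\<Sum>k=1..K. gauss_cdf (1 / (real k + c)) - gauss_cdf (1 / (real k + d)))
      = (ln ((real K + 1 + c) / (1 + c)) - ln ((real K + 1 + d) / (1 + d))) / ln 2" for K
  proof -
    have "(\<Sum>k=1..K. gauss_cdf (1 / (real k + b))) = ln ((real K + 1 + b) / (1 + b)) / ln 2"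
      if "0 \<le> b" for b
    proof -
      have "(\<Sum>k=1..K. gauss_cdf (1 / (real k + b)))
          = (\<Sum>k=1..K. ln ((real k + 1 + b) / (real k + b)) / ln 2)"
        using that by (intro sum.cong refl gauss_cdf_inverse) auto
      then show ?thesis
        by (simp only: sum_divide_distrib[symmetric] sum_ln_telescope[OF that])
    qed
    then show ?thesis using assms by (simp add: sum_subtractf diff_divide_distrib)
  qed
  ultimately show ?thesis by simp
qed

text \<open>Invariance of the Gauss measure: both \<open>T z < q\<close> and its complement contain the union of
  infinitely many intervals, one for each value of the first digit, whose measures add up to the
  expected value.\<close>

lemma gauss_distributed_gauss_map:
  assumes "gauss_distributed z" "\<And>n. z n \<in> unit_irrationals"
  shows "gauss_distributed (\<lambda>n. gauss_map (z n))"
  unfolding gauss_distributed_def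
proof
  fix q :: real
  note z = unit_irrationals_bounds[OF assms(2)]
  note Tz = unit_irrationals_bounds[OF gauss_map_closed[OF assms(2)]]
  let ?P = "\<lambda>n. gauss_map (z n) < q"
  consider "q \<le> 0" | "1 \<le> q" | "0 < q" "q < 1" by linarith
  then show "freq ?P \<longlonglongrightarrow> gauss_cdf q"
  proof cases
    case 1
    then have "\<not> ?P n" for n using Tz(1)[of n] by simp
    then show ?thesis using 1 by (simp add: freq_def[abs_def] gauss_cdf_eq)
  next
    case 2
    then have P: "?P n" for n using Tz(2)[of n] by simp
    have "\<forall>\<^sub>F N in sequentially. freq ?P N = 1"
      using eventually_gt_at_top[of 0] by eventually_elim (simp add: freq_def P)
    then show ?thesis using 2 by (simp add: gauss_cdf_eq tendsto_eventually)
  next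
    case 3
    \<comment> \<open>For first digit \<open>k\<close> the Gauss map is \<open>1 / z - k\<close>.
      The intervals in \<open>lo\<close> are those where it lies between \<open>0\<close> and
      \<open>q\<close>, the ones in \<open>hi\<close> those where it lies between \<open>q\<close>
      and \<open>1\<close>.\<close>
    define lo where "lo K N = (\<Sum>k=1..K. freq (\<lambda>n. 1 / (real k + q) < z n \<and> z n < 1 / real k) N)" for K N
    define hi where "hi K N = (\<Sum>k=1..K. freq (\<lambda>n. 1 / (real k + 1) < z n \<and> z n < 1 / (real k + q)) N)" for K N
    have digit: "\<lfloor>1 / z n\<rfloor> = int k" if "k \<in> {1..K}" "1 / (real k + 1) < z n" "z n < 1 / real k" for k n K
      using that z(1)[of n] by (subst floor_inverse_eq) auto
    have mono: "1 / (real k + 1) < 1 / (real k + q)" "1 / (real k + q) < 1 / real k" if "k \<in> {1..K}" for k K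
      using that 3 by (auto intro!: divide_strict_left_mono mult_pos_pos add_pos_pos)
    have lo: "lo K N \<le> freq ?P N" for K N
      unfolding lo_def
    proof (rule sum_freq_le)
      fix k n assume k: "k \<in> {1..K}" and zn: "1 / (real k + q) < z n \<and> z n < 1 / real k"
      have "1 / z n < real k + q"
        using zn z(1)[of n] k 3 by (simp add: field_simps)
      then show "gauss_map (z n) < q"
        using digit[OF k] zn mono(1)[OF k] by (simp add: gauss_map_def)
    next
      fix k l n assume "k \<in> {1..K}" "l \<in> {1..K}" "1 / (real k + q) < z n \<and> z n < 1 / real k"
        "1 / (real l + q) < z n \<and> z n < 1 / real l"
      then show "k = l" using digit[of k K n] digit[of l K n] mono(1)[of k K] mono(1)[of l K] by auto
    qed simp
    have hi: "hi K N \<le> freq (\<lambda>n. \<not> ?P n) N" for K N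
      unfolding hi_def
    proof (rule sum_freq_le)
      fix k n assume k: "k \<in> {1..K}" and zn: "1 / (real k + 1) < z n \<and> z n < 1 / (real k + q)"
      have "real k + q < 1 / z n"
        using zn z(1)[of n] k 3 by (simp add: field_simps)
      then show "\<not> gauss_map (z n) < q"
        using digit[OF k] zn mono(2)[OF k] by (simp add: gauss_map_def)
    next
      fix k l n assume "k \<in> {1..K}" "l \<in> {1..K}" "1 / (real k + 1) < z n \<and> z n < 1 / (real k + q)"
        "1 / (real l + 1) < z n \<and> z n < 1 / (real l + q)"
      then show "k = l" using digit[of k K n] digit[of l K n] mono(2)[of k K] mono(2)[of l K] by auto
    qed simp
    define slo where "slo K = (\<Sum>k=1..K. gauss_cdf (1 / (real k + 0)) - gauss_cdf (1 / (real k + q)))" for K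
    define shi where "shi K = (\<Sum>k=1..K. gauss_cdf (1 / (real k + q)) - gauss_cdf (1 / (real k + 1)))" for K
    have lo_lim: "lo K \<longlonglongrightarrow> slo K" for K
      unfolding lo_def[abs_def] slo_def add_0_right
      by (intro tendsto_sum gauss_distributed_between(1) assms(1) less_imp_le mono(2))
    have hi_lim: "hi K \<longlonglongrightarrow> shi K" for K
      unfolding hi_def[abs_def] shi_def
      by (intro tendsto_sum gauss_distributed_between(1) assms(1) less_imp_le mono(1))
    have slo: "slo \<longlonglongrightarrow> gauss_cdf q"
      using sum_gauss_cdf_inverse[of 0 q] 3 by (simp add: slo_def[abs_def] gauss_cdf_eq)
    have shi: "shi \<longlonglongrightarrow> 1 - gauss_cdf q"
      using sum_gauss_cdf_inverse[of q 1] 3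
      by (simp add: shi_def[abs_def] gauss_cdf_eq diff_divide_distrib)
    show ?thesis
    proof (rule tendsto_squeeze_approx)
      fix e :: real assume "0 < e"
      then have "\<forall>\<^sub>F K in sequentially. gauss_cdf q - e < slo K"
          "\<forall>\<^sub>F K in sequentially. 1 - gauss_cdf q - e < shi K"
        by (intro order_tendstoD(1)[OF slo] order_tendstoD(1)[OF shi]; simp)+
      then have "\<forall>\<^sub>F K in sequentially. gauss_cdf q - e < slo K \<and> 1 - gauss_cdf q - e < shi K"
        by eventually_elim simp
      then obtain K where K: "gauss_cdf q - e < slo K" "1 - gauss_cdf q - e < shi K"
        using eventually_happens'[OF sequentially_bot] by blast
      have "\<forall>\<^sub>F N in sequentially. lo K N \<le> freq ?P N \<and> freq ?P N \<le> 1 - hi K N"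
        using eventually_gt_at_top[of 0]
      proof eventually_elim
        case (elim N)
        then show ?case using lo[of K N] hi[of K N] freq_not[of N ?P] by simp
      qed
      moreover have "(\<lambda>N. 1 - hi K N) \<longlonglongrightarrow> 1 - shi K"
        by (intro tendsto_intros hi_lim)
      moreover have "1 - shi K < gauss_cdf q + e" using K by simp
      ultimately show "\<exists>g h a b. (g \<longlonglongrightarrow> a) \<and> (h \<longlonglongrightarrow> b) \<and> gauss_cdf q - e < a \<and> b < gauss_cdf q + e \<and>
          (\<forall>\<^sub>F N in sequentially. g N \<le> freq ?P N \<and> freq ?P N \<le> h N)"
        using K(1) lo_lim[of K] by blast
    qed
  qed
qed

lemma gauss_distributed_gauss_map_funpow:
  assumes "gauss_distributed z" "\<And>n. z n \<in> unit_irrationals"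
  shows "gauss_distributed (\<lambda>n. (gauss_map ^^ k) (z n))"
proof (induction k)
  case (Suc k)
  then show ?case
    using gauss_distributed_gauss_map[OF Suc] gauss_map_funpow_closed assms(2) by simp
qed (use assms in simp)

section \<open>An explicit equidistributed sequence\<close>

text \<open>The binary radical inverse: the binary digits of \<open>n\<close> are reflected at the
  binary point.\<close>

fun van_der_corput :: "nat \<Rightarrow> real" where
  "van_der_corput n = (if n = 0 then 0 else (van_der_corput (n div 2) + real (n mod 2)) / 2)"

declare van_der_corput.simps [simp del]

lemma van_der_corput_bounds: "0 \<le> van_der_corput n \<and> van_der_corput n < 1"
proof (induction n rule: less_induct)
  case (less n)
  show ?case
  proof (cases "n = 0")
    case True
    then show ?thesis by (subst (1 2) van_der_corput.simps) simp
  next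
    case False
    have "real (n mod 2) \<le> 1" by simp
    moreover have "0 \<le> van_der_corput (n div 2) \<and> van_der_corput (n div 2) < 1"
      using less[of "n div 2"] False by simp
    moreover have "van_der_corput n = (van_der_corput (n div 2) + real (n mod 2)) / 2"
      using False by (subst van_der_corput.simps) simp
    ultimately show ?thesis by simp
  qed
qed

lemma van_der_corput_digits:
  "van_der_corput (j * 2 + 0) = van_der_corput j / 2"
  "van_der_corput (j * 2 + 1) = (van_der_corput j + 1) / 2"
proof -
  have "van_der_corput 0 = 0" by (subst van_der_corput.simps) simp
  then show "van_der_corput (j * 2 + 0) = van_der_corput j / 2"
  proof (cases "j = 0")
    case False
    then show ?thesis by (subst van_der_corput.simps) simp
  qed simp
  show "van_der_corput (j * 2 + 1) = (van_der_corput j + 1) / 2"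
    by (subst van_der_corput.simps) (simp add: mod_Suc)
qed

text \<open>Even indices give a half-scale copy of the sequence in the left half of the unit
  interval, odd indices one in the right half. The threshold \<open>k / 2 ^ Suc m\<close> thus
  becomes \<open>k / 2 ^ m\<close> and \<open>(k - 2 ^ m) / 2 ^ m\<close> on the two classes;
  allowing every integer \<open>k\<close>, with a clamped limit, closes the induction.\<close>

lemma freq_van_der_corput_dyadic:
  "freq (\<lambda>n. van_der_corput n < of_int k / 2 ^ m) \<longlonglongrightarrow> max 0 (min 1 (of_int k / 2 ^ m))"
proof (induction m arbitrary: k)
  case 0
  have vdc: "0 \<le> van_der_corput n" "van_der_corput n < 1" for n
    using van_der_corput_bounds[of n] by auto
  show ?case
  proof (cases "k \<le> 0")
    case True
    then have "\<not> van_der_corput n < of_int k" for n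
      using vdc(1)[of n] by (meson not_less of_int_le_0_iff order_trans)
    then show ?thesis using True by (simp add: freq_def[abs_def])
  next
    case False
    then have k: "1 \<le> real_of_int k" by simp
    then have vk: "van_der_corput n < of_int k" for n
      using vdc(2)[of n] by linarith
    have "\<forall>\<^sub>F N in sequentially. freq (\<lambda>n. van_der_corput n < of_int k / 2 ^ 0) N = 1"
      using eventually_gt_at_top[of 0] by eventually_elim (simp add: freq_def vk)
    then show ?thesis using k by (simp add: tendsto_eventually)
  qed
next
  case (Suc m)
  define l where "l i = max 0 (min 1 (of_int (if i = 0 then k else k - 2 ^ m) / 2 ^ m :: real))" for i :: nat
  have "freq (\<lambda>j. van_der_corput (j * 2 + i) < of_int k / 2 ^ Suc m) \<longlonglongrightarrow> l i" if "i < 2" for i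
  proof -
    from that consider "i = 0" | "i = 1" by linarith
    then show ?thesis
    proof cases
      case 1
      have "freq (\<lambda>j. van_der_corput (j * 2 + i) < of_int k / 2 ^ Suc m)
          = freq (\<lambda>j. van_der_corput j < of_int k / 2 ^ m)"
        unfolding 1 van_der_corput_digits by (simp add: field_simps)
      then show ?thesis using Suc[of k] 1 by (simp add: l_def)
    next
      case 2
      have "freq (\<lambda>j. van_der_corput (j * 2 + i) < of_int k / 2 ^ Suc m)
          = freq (\<lambda>j. van_der_corput j < of_int (k - 2 ^ m) / 2 ^ m)"
        unfolding 2 van_der_corput_digits by (simp add: field_simps)
      then show ?thesis using Suc[of "k - 2 ^ m"] 2 by (simp add: l_def)
    qed
  qed
  then have "freq (\<lambda>n. van_der_corput n < of_int k / 2 ^ Suc m) \<longlonglongrightarrow> (\<Sum>i<2. l i) / real 2"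
    by (intro freq_interleave) auto
  also have "(\<Sum>i<2. l i) / real 2 = max 0 (min 1 (of_int k / 2 ^ Suc m))"
  proof -
    define s where "s = of_int k / (2::real) ^ m"
    have "of_int (k - 2 ^ m) / (2::real) ^ m = s - 1"
      by (simp add: s_def diff_divide_distrib)
    then have "(\<Sum>i<2. l i) = max 0 (min 1 s) + max 0 (min 1 (s - 1))"
      by (simp add: l_def s_def numeral_2_eq_2)
    also have "\<dots> = 2 * max 0 (min 1 (s / 2))" by (auto simp: max_def min_def)
    finally show ?thesis by (simp add: s_def)
  qed
  finally show ?case .
qed

lemma freq_van_der_corput:
  assumes "0 \<le> s" "s \<le> 1"
  shows "freq (\<lambda>n. van_der_corput n < s) \<longlonglongrightarrow> s"
proof (rule tendsto_squeeze_approx)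
  fix e :: real assume "0 < e"
  then obtain m where "(1/2::real) ^ m < e"
    using real_arch_pow_inv[of e "1/2"] by auto
  then have m: "1 / (2::real) ^ m < e" by (simp add: power_divide)
  define k where "k = \<lfloor>s * 2 ^ m\<rfloor>"
  define a where "a = of_int k / (2::real) ^ m"
  define b where "b = of_int (k + 1) / (2::real) ^ m"
  have "of_int k \<le> s * 2 ^ m" "s * 2 ^ m < of_int k + 1"
    by (auto simp: k_def)
  then have ab: "a \<le> s" "s < b" "b = a + 1 / 2 ^ m"
    by (auto simp: a_def b_def field_simps)
  have "0 \<le> k" using assms by (simp add: k_def)
  then have a0: "0 \<le> a" by (simp add: a_def)
  have "freq (\<lambda>n. van_der_corput n < a) \<longlonglongrightarrow> max 0 (min 1 a)"
    "freq (\<lambda>n. van_der_corput n < b) \<longlonglongrightarrow> max 0 (min 1 b)"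
    unfolding a_def b_def by (rule freq_van_der_corput_dyadic)+
  moreover have "s - e < max 0 (min 1 a)" "max 0 (min 1 b) < s + e"
    using ab a0 m assms by auto
  moreover have "freq (\<lambda>n. van_der_corput n < a) N \<le> freq (\<lambda>n. van_der_corput n < s) N"
      "freq (\<lambda>n. van_der_corput n < s) N \<le> freq (\<lambda>n. van_der_corput n < b) N" for N
    using ab by (auto intro!: freq_mono)
  ultimately show "\<exists>g h a b. (g \<longlonglongrightarrow> a) \<and> (h \<longlonglongrightarrow> b) \<and> s - e < a \<and> b < s + e \<and>
      (\<forall>\<^sub>F N in sequentially. g N \<le> freq (\<lambda>n. van_der_corput n < s) N \<and>
        freq (\<lambda>n. van_der_corput n < s) N \<le> h N)"
    by (intro exI[of _ "freq (\<lambda>n. van_der_corput n < a)"] exI[of _ "freq (\<lambda>n. van_der_corput n < b)"]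
        exI[of _ "max 0 (min 1 a)"] exI[of _ "max 0 (min 1 b)"] conjI always_eventually allI)
qed

text \<open>On the unit interval \<open>2 powr s - 1\<close> inverts \<open>gauss_cdf\<close>, so it
  carries uniform distribution to Gauss distribution.\<close>

lemma gauss_distributed_van_der_corput:
  "gauss_distributed (\<lambda>n. 2 powr van_der_corput n - 1)"
  unfolding gauss_distributed_def
proof
  fix q :: real
  have vdc: "0 \<le> van_der_corput n" "van_der_corput n < 1" for n
    using van_der_corput_bounds[of n] by auto
  have "2 powr van_der_corput n - 1 < q \<longleftrightarrow> van_der_corput n < gauss_cdf q" for n
  proof -
    have "1 \<le> 2 powr van_der_corput n" "2 powr van_der_corput n < 2"
      using vdc[of n] powr_less_cancel_iff[of 2 "van_der_corput n" 1] by (auto intro: ge_one_powr_ge_zero)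
    then have "2 powr van_der_corput n - 1 < q \<longleftrightarrow> 2 powr van_der_corput n < 1 + max 0 (min 1 q)"
      by auto
    also have "\<dots> \<longleftrightarrow> van_der_corput n < gauss_cdf q"
      unfolding gauss_cdf_def by (subst less_log_iff) auto
    finally show ?thesis .
  qed
  then show "freq (\<lambda>n. 2 powr van_der_corput n - 1 < q) \<longlonglongrightarrow> gauss_cdf q"
    using freq_van_der_corput[OF gauss_cdf_bounds] by simp
qed

lemma unit_irrationals_dense:
  fixes t e :: real
  assumes "0 \<le> t" "t < 1" "0 < e"
  obtains x where "x \<in> unit_irrationals" "\<bar>x - t\<bar> < e"
proof -
  have "uncountable ({t<..<min 1 (t + e)} - \<rat>)"
    using assms by (intro uncountable_minus_countable uncountable_open_interval[THEN iffD2] countable_rat) auto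
  then obtain x where "x \<in> {t<..<min 1 (t + e)} - \<rat>"
    by (metis all_not_in_conv countable_empty)
  then show thesis
    using assms by (intro that[of x]) (auto simp: unit_irrationals_def)
qed

text \<open>The previous sequence starts with the rational \<open>0\<close>; moving the
  \<open>n\<close>-th term by less than \<open>1 / (n + 1)\<close> to an irrational does not affect
  the distribution.\<close>

lemma exists_gauss_distributed_irrationals:
  obtains x where "gauss_distributed x" "\<And>n. x n \<in> unit_irrationals"
proof -
  define t where "t n = 2 powr van_der_corput n - 1" for n
  have "\<exists>x. x \<in> unit_irrationals \<and> \<bar>x - t n\<bar> < 1 / real (Suc n)" for n
  proof -
    have "0 \<le> t n" "t n < 1"
      using van_der_corput_bounds[of n] powr_less_cancel_iff[of 2 "van_der_corput n" 1]
      by (auto simp: t_def intro: ge_one_powr_ge_zero)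
    then show ?thesis using unit_irrationals_dense[of "t n" "1 / real (Suc n)"] by auto
  qed
  then obtain x where x: "\<And>n. x n \<in> unit_irrationals" "\<And>n. \<bar>x n - t n\<bar> < 1 / real (Suc n)"
    by metis
  have "zero_density (\<lambda>n. e \<le> \<bar>x n - t n\<bar>)" if "0 < e" for e
  proof -
    from that obtain k where k: "1 / real (Suc k) < e" by (rule nat_approx_posE)
    have "n < k" if "e \<le> \<bar>x n - t n\<bar>" for n
    proof (rule ccontr)
      assume "\<not> n < k"
      then have "1 / real (Suc n) \<le> 1 / real (Suc k)" by (intro divide_left_mono) auto
      then show False using x(2)[of n] k that by linarith
    qed
    then show ?thesis by (rule zero_density_bounded)
  qed
  then have "gauss_distributed x"
    using gauss_distributed_perturb[OF gauss_distributed_van_der_corput] by (simp add: t_def)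
  from this x(1) show thesis by (rule that)
qed

subsection \<open>An equidistributed pseudo-orbit and its shadow\<close>

text \<open>A diagonal argument: each row is followed until the next one has become accurate, on time
  scales growing so fast that everything before the last switch is negligible.\<close>

lemma glue_null_averages:
  fixes D :: "nat \<Rightarrow> nat \<Rightarrow> nat \<Rightarrow> real"
  assumes D1: "\<And>c L i. \<bar>D c L i\<bar> \<le> 1"
    and lim: "\<And>c L. (\<lambda>n. (\<Sum>i<n. D c L i) / real n) \<longlonglongrightarrow> 0"
  obtains N :: "nat \<Rightarrow> nat" where "strict_mono N" "\<And>L. 2 ^ L dvd N L"
    "\<And>c. (\<lambda>n. (\<Sum>i<n. D c (LEAST L. i < N L) i) / real n) \<longlonglongrightarrow> 0"
proof -
  define S where "S c L n = (\<Sum>i<n. D c L i)" for c L n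
  \<comment> \<open>From time \<open>K L\<close> on, row \<open>L\<close> is accurate to
    \<open>1 / (L + 1)\<close> for the first \<open>L + 1\<close> tests simultaneously.\<close>
  have "\<exists>K. \<forall>n\<ge>K. \<forall>c\<le>L. \<bar>S c L n\<bar> \<le> real n / real (L + 1)" for L
  proof -
    have "\<forall>\<^sub>F n in sequentially. \<forall>c\<in>{..L}. \<bar>S c L n / real n\<bar> < 1 / real (L + 1)"
    proof (intro eventually_ball_finite ballI)
      fix c
      show "\<forall>\<^sub>F n in sequentially. \<bar>S c L n / real n\<bar> < 1 / real (L + 1)"
        using tendstoD[OF lim[of c L], of "1 / real (L + 1)"] by (simp add: S_def dist_real_def)
    qed simp
    then obtain K where K: "\<And>n c. K \<le> n \<Longrightarrow> c \<le> L \<Longrightarrow> \<bar>S c L n / real n\<bar> < 1 / real (L + 1)"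
      unfolding eventually_sequentially by auto
    have "\<bar>S c L n\<bar> \<le> real n / real (L + 1)" if "K + 1 \<le> n" "c \<le> L" for n c
      using K[of n c] that by (simp add: field_simps abs_divide)
    then show ?thesis by blast
  qed
  then obtain K where K: "\<And>L n c. K L \<le> n \<Longrightarrow> c \<le> L \<Longrightarrow> \<bar>S c L n\<bar> \<le> real n / real (L + 1)"
    by metis
  \<comment> \<open>Row \<open>L + 1\<close> is used from \<open>N L\<close> up to
    \<open>N (Suc L)\<close>. The factor \<open>L + 2\<close> makes the time before
    \<open>N L\<close> negligible at \<open>N (Suc L)\<close>, the summand \<open>K (L + 2)\<close>
    ensures that the next row is accurate when it takes over, and the power of two gives the
    divisibility.\<close>
  define N where "N = rec_nat (Suc (K 1)) (\<lambda>L NL. 2 ^ Suc L * ((L + 2) * NL + K (L + 2)))"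
  have N_0: "N 0 = Suc (K 1)" by (simp add: N_def)
  have N_Suc: "N (Suc L) = 2 ^ Suc L * ((L + 2) * N L + K (L + 2))" for L by (simp add: N_def)
  have step: "(L + 2) * N L + K (L + 2) \<le> N (Suc L)" for L
    unfolding N_Suc by simp
  have pos: "0 < N L" for L
    by (induction L) (simp_all add: N_0 N_Suc)
  have "N L < N (Suc L)" for L
  proof -
    have "N L < (L + 2) * N L" using pos[of L] by simp
    then show ?thesis using step[of L] by linarith
  qed
  then have mono: "strict_mono N" by (simp add: strict_mono_Suc_iff)
  have dvd: "2 ^ L dvd N L" for L by (cases L) (simp_all add: N_Suc)
  have K_le: "K (Suc L) \<le> N L" for L
  proof (cases L)
    case (Suc l)
    then show ?thesis using step[of l] by simp
  qed (simp add: N_0)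
  define lev where "lev n = (LEAST L. n < N L)" for n
  have lev_eq: "lev n = Suc L" if "N L \<le> n" "n < N (Suc L)" for n L
    unfolding lev_def
  proof (rule Least_equality)
    fix y assume "n < N y"
    then have "N L < N y" using that by linarith
    then show "Suc L \<le> y" using strict_mono_less[OF mono] by simp
  qed fact
  have "(\<lambda>n. (\<Sum>i<n. D c (lev i) i) / real n) \<longlonglongrightarrow> 0" for c
  proof -
    define T where "T n = (\<Sum>i<n. D c (lev i) i)" for n
    have T_triv: "\<bar>T n\<bar> \<le> real n" for n
      using order_trans[OF sum_abs sum_mono[of "{..<n}" "\<lambda>i. \<bar>D c (lev i) i\<bar>" "\<lambda>_. 1"]] D1
      by (simp add: T_def)
    have T_eq: "T n = T (N L) + (S c (Suc L) n - S c (Suc L) (N L))" if "N L \<le> n" "n \<le> N (Suc L)" for L n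
    proof -
      have split: "(\<Sum>i<n. f i) = (\<Sum>i<N L. f i) + (\<Sum>i=N L..<n. f i)" for f :: "nat \<Rightarrow> real"
        using sum.atLeastLessThan_concat[of 0 "N L" n f] that by (simp add: lessThan_atLeast0)
      have "(\<Sum>i=N L..<n. D c (lev i) i) = (\<Sum>i=N L..<n. D c (Suc L) i)"
        using lev_eq that by (intro sum.cong) auto
      then show ?thesis
        using split[of "\<lambda>i. D c (lev i) i"] split[of "D c (Suc L)"] by (simp add: T_def S_def)
    qed
    \<comment> \<open>The five errors are the trivial bound at \<open>N L\<close> and two partial
      sums from each of the rows \<open>L + 1\<close> and \<open>L + 2\<close>; each is at most
      \<open>n / (L + 2)\<close>.\<close>
    have bound: "\<bar>T n\<bar> \<le> 5 * real n / real (L + 2)"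
      if "c \<le> L" "N (Suc L) \<le> n" "n \<le> N (Suc (Suc L))" for n L
    proof -
      have le: "N L \<le> N (Suc L)" using mono by (simp add: strict_mono_less_eq)
      have 1: "real (N L) \<le> real n / real (L + 2)"
      proof -
        have "(L + 2) * N L \<le> n" using step[of L] that by linarith
        then have "real (L + 2) * real (N L) \<le> real n"
          unfolding of_nat_mult[symmetric] of_nat_le_iff .
        then show ?thesis by (simp add: field_simps)
      qed
      have 2: "\<bar>S c (Suc L) m\<bar> \<le> real n / real (L + 2)" if "N L \<le> m" "m \<le> n" for m
      proof -
        have "\<bar>S c (Suc L) m\<bar> \<le> real m / real (L + 2)"
          using K[of "Suc L" m c] K_le[of L] that \<open>c \<le> L\<close> by simp
        also have "\<dots> \<le> real n / real (L + 2)" using that by (intro divide_right_mono) auto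
        finally show ?thesis .
      qed
      have 3: "\<bar>S c (Suc (Suc L)) m\<bar> \<le> real n / real (L + 2)" if "N (Suc L) \<le> m" "m \<le> n" for m
      proof -
        have "\<bar>S c (Suc (Suc L)) m\<bar> \<le> real m / real (L + 3)"
          using K[of "Suc (Suc L)" m c] K_le[of "Suc L"] that \<open>c \<le> L\<close> by (simp add: eval_nat_numeral)
        also have "\<dots> \<le> real n / real (L + 2)" using that by (intro frac_le) auto
        finally show ?thesis .
      qed
      have "T n = T (N L) + (S c (Suc L) (N (Suc L)) - S c (Suc L) (N L))
          + (S c (Suc (Suc L)) n - S c (Suc (Suc L)) (N (Suc L)))"
        using T_eq[of L "N (Suc L)"] T_eq[of "Suc L" n] that le by simp
      then have "\<bar>T n\<bar> \<le> 5 * (real n / real (L + 2))"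
        using 1 2[of "N L"] 2[of "N (Suc L)"] 3[of n] 3[of "N (Suc L)"] T_triv[of "N L"] that le
        by linarith
      then show ?thesis by simp
    qed
    show "(\<lambda>n. (\<Sum>i<n. D c (lev i) i) / real n) \<longlonglongrightarrow> 0"
      unfolding T_def[symmetric]
    proof (rule tendstoI)
      fix e :: real assume "0 < e"
      \<comment> \<open>\<open>L0\<close> makes the five errors together smaller than
        \<open>e\<close>; the maximum with \<open>c\<close> ensures that test \<open>c\<close> is
        among those controlled.\<close>
      obtain L0 :: nat where L0: "5 / e < real L0" using reals_Archimedean2 by blast
      define L1 where "L1 = max c L0"
      show "\<forall>\<^sub>F n in sequentially. dist (T n / real n) 0 < e"
        using eventually_ge_at_top[of "N (Suc L1)"]
      proof eventually_elim
        case (elim n)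
        have n: "n < N (lev n)"
          unfolding lev_def using strict_mono_imp_increasing[OF mono, of "Suc n"]
          by (intro LeastI[of "\<lambda>L. n < N L" "Suc n"]) simp
        have "N (Suc L1) < N (lev n)" using elim n by linarith
        then have "Suc L1 < lev n" using strict_mono_less[OF mono] by simp
        then have "lev n = Suc (Suc (lev n - 2))" "L1 \<le> lev n - 2" by simp_all
        then obtain L where L: "lev n = Suc (Suc L)" "L1 \<le> L" by blast
        have "N (Suc L) \<le> n"
          using not_less_Least[of "Suc L" "\<lambda>L. n < N L"] L(1) by (simp add: lev_def)
        then have b: "\<bar>T n\<bar> \<le> 5 * real n / real (L + 2)"
          using n L by (intro bound) (auto simp: L1_def)
        have "0 < real n" using elim pos[of "Suc L1"] by simp
        then have "\<bar>T n / real n\<bar> \<le> 5 / real (L + 2)"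
          using divide_right_mono[OF b, of "real n"] by simp
        also have "\<dots> < e"
        proof -
          have "5 / e < real (L + 2)" using L0 L(2) by (simp add: L1_def)
          then show ?thesis using \<open>0 < e\<close> by (simp add: field_simps)
        qed
        finally show ?case by simp
      qed
    qed
  qed
  then show thesis
    using mono dvd by (intro that[of N]) (auto simp: lev_def)
qed

lemma freq_dvd_Suc:
  assumes "0 < m"
  shows "freq (\<lambda>n. m dvd Suc n) \<longlonglongrightarrow> 1 / real m"
proof -
  have "freq (\<lambda>j. m dvd Suc (j * m + i)) \<longlonglongrightarrow> (if i = m - 1 then 1 else 0)" if "i < m" for i
  proof -
    have "m dvd Suc (j * m + i) \<longleftrightarrow> m dvd Suc i" for j
      using dvd_add_right_iff[of m "j * m" "Suc i"] by simp
    moreover have "m dvd Suc i \<longleftrightarrow> i = m - 1"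
      using that assms by (auto dest: dvd_imp_le)
    ultimately have eq: "m dvd Suc (j * m + i) \<longleftrightarrow> i = m - 1" for j by simp
    have "\<forall>\<^sub>F N in sequentially. freq (\<lambda>j. m dvd Suc (j * m + i)) N = (if i = m - 1 then 1 else 0)"
      using eventually_gt_at_top[of 0] by eventually_elim (simp add: freq_def eq)
    then show ?thesis by (rule tendsto_eventually)
  qed
  from freq_interleave[OF assms this]
  have "freq (\<lambda>n. m dvd Suc n) \<longlonglongrightarrow> (\<Sum>i<m. if i = m - 1 then 1 else 0) / real m" .
  then show ?thesis using assms by simp
qed

lemma tendsto_freq_iff_average:
  "freq P \<longlonglongrightarrow> l \<longleftrightarrow> (\<lambda>N. (\<Sum>n<N. of_bool (P n) - l) / real N) \<longlonglongrightarrow> 0"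
proof -
  have "\<forall>\<^sub>F N in sequentially. (\<Sum>n<N. of_bool (P n) - l) / real N = freq P N - l"
    using eventually_gt_at_top[of 0]
    by eventually_elim (simp add: freq_def sum_subtractf diff_divide_distrib)
  then have "(\<lambda>N. (\<Sum>n<N. of_bool (P n) - l) / real N) \<longlonglongrightarrow> 0 \<longleftrightarrow> (\<lambda>N. freq P N - l) \<longlonglongrightarrow> 0"
    by (rule tendsto_cong)
  then show ?thesis by (simp add: LIM_zero_iff)
qed

lemma exists_gauss_distributed_pseudo_orbit:
  obtains z where "gauss_distributed z" "\<And>n. z n \<in> unit_irrationals"
    "zero_density (\<lambda>n. z (Suc n) \<noteq> gauss_map (z n))"
proof -
  obtain x where x: "gauss_distributed x" "\<And>n. x n \<in> unit_irrationals"
    using exists_gauss_distributed_irrationals by blast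
  \<comment> \<open>Row \<open>L\<close> concatenates the orbit segments of length
    \<open>2 ^ L\<close> of the points \<open>x 0\<close>, \<open>x 1\<close>, and so on. Along
    residue \<open>i\<close> modulo \<open>2 ^ L\<close> it is the image of \<open>x\<close> under
    the \<open>i\<close>-th iterate, equidistributed by invariance.\<close>
  define w where "w L n = (gauss_map ^^ (n mod 2 ^ L)) (x (n div 2 ^ L))" for L n :: nat
  have w: "freq (\<lambda>n. w L n < q) \<longlonglongrightarrow> gauss_cdf q" for L q
  proof -
    have "freq (\<lambda>j. w L (j * 2 ^ L + i) < q) \<longlonglongrightarrow> gauss_cdf q" if "i < 2 ^ L" for i
      using gauss_distributedD[OF gauss_distributed_gauss_map_funpow[OF x]] that
      by (simp add: w_def)
    then have "freq (\<lambda>n. w L n < q) \<longlonglongrightarrow> (\<Sum>i<(2::nat) ^ L. gauss_cdf q) / real (2 ^ L)"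
      by (intro freq_interleave) auto
    then show ?thesis by simp
  qed
  \<comment> \<open>The tests of the diagonal argument are indexed by natural numbers, so the
    rational thresholds are enumerated.\<close>
  define rat where "rat c = real_of_rat (from_nat c)" for c
  define D where "D c L i = of_bool (w L i < rat c) - gauss_cdf (rat c)" for c L i
  have "\<bar>D c L i\<bar> \<le> 1" for c L i
    using gauss_cdf_bounds[of "rat c"] by (auto simp: D_def)
  moreover have "(\<lambda>n. (\<Sum>i<n. D c L i) / real n) \<longlonglongrightarrow> 0" for c L
    unfolding D_def by (rule tendsto_freq_iff_average[THEN iffD1, OF w])
  ultimately obtain N where N: "strict_mono N" "\<And>L. 2 ^ L dvd N L"
      "\<And>c. (\<lambda>n. (\<Sum>i<n. D c (LEAST L. i < N L) i) / real n) \<longlonglongrightarrow> 0"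
    using glue_null_averages by blast
  define lev where "lev n = (LEAST L. n < N L)" for n
  define z where "z n = w (lev n) n" for n
  have lev: "n < N (lev n)" for n
    unfolding lev_def using strict_mono_imp_increasing[OF N(1), of "Suc n"]
    by (intro LeastI[of "\<lambda>L. n < N L" "Suc n"]) simp
  have lev_gt: "L < lev n" if "N L \<le> n" for n L
  proof -
    have "N L < N (lev n)" using lev[of n] that by linarith
    then show ?thesis using strict_mono_less[OF N(1)] by simp
  qed
  have "gauss_distributed z"
  proof (rule gauss_distributed_dense)
    fix q :: rat
    have "rat (to_nat q) = real_of_rat q" by (simp add: rat_def)
    then show "freq (\<lambda>n. z n < real_of_rat q) \<longlonglongrightarrow> gauss_cdf (real_of_rat q)"
      using N(3)[of "to_nat q"] unfolding tendsto_freq_iff_average by (simp add: D_def z_def lev_def)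
  qed
  moreover have "z n \<in> unit_irrationals" for n
    unfolding z_def w_def by (intro gauss_map_funpow_closed x)
  moreover have "zero_density (\<lambda>n. z (Suc n) \<noteq> gauss_map (z n))"
  proof (rule zero_density_mono)
    fix n assume neq: "z (Suc n) \<noteq> gauss_map (z n)"
    \<comment> \<open>A break can occur only where a segment ends. Inside a row that is at multiples
      of \<open>2 ^ lev n\<close>, and the time \<open>N (lev n)\<close> of the next switch is such
      a multiple too.\<close>
    show "2 ^ lev n dvd Suc n"
    proof (rule ccontr)
      assume ndvd: "\<not> 2 ^ lev n dvd Suc n"
      then have "Suc n \<noteq> N (lev n)" using N(2) by metis
      then have "Suc n < N (lev n)" using lev[of n] by simp
      then have "lev (Suc n) = lev n"
        unfolding lev_def[of "Suc n"]
      proof (rule Least_equality)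
        fix y assume "Suc n < N y"
        then have "n < N y" by simp
        then show "lev n \<le> y" unfolding lev_def by (rule Least_le)
      qed
      moreover have "Suc n mod 2 ^ lev n = Suc (n mod 2 ^ lev n)" "Suc n div 2 ^ lev n = n div 2 ^ lev n"
        using ndvd by (auto simp: mod_Suc div_Suc dvd_eq_mod_eq_0 split: if_splits)
      ultimately show False using neq by (simp add: z_def w_def)
    qed
  next
    show "zero_density (\<lambda>n. 2 ^ lev n dvd Suc n)"
      unfolding zero_density_def
    proof (rule tendsto_squeeze_approx)
      fix e :: real assume "0 < e"
      \<comment> \<open>From \<open>N L\<close> on, every segment length is a multiple of
        \<open>2 ^ L\<close>, so the breaks have upper density at most
        \<open>1 / 2 ^ L\<close>.\<close>
      then obtain L where "(1/2::real) ^ L < e"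
        using real_arch_pow_inv[of e "1/2"] by auto
      then have L: "1 / real (2 ^ L) < 0 + e" by (simp add: power_divide)
      have "zero_density (\<lambda>n. n < N L)" by (rule zero_density_bounded)
      then have "(\<lambda>M. freq (\<lambda>n. n < N L) M + freq (\<lambda>n. 2 ^ L dvd Suc n) M) \<longlonglongrightarrow> 0 + 1 / real (2 ^ L)"
        unfolding zero_density_def by (intro tendsto_add freq_dvd_Suc) auto
      moreover have "freq (\<lambda>n. 2 ^ lev n dvd Suc n) M
          \<le> freq (\<lambda>n. n < N L) M + freq (\<lambda>n. 2 ^ L dvd Suc n) M" for M
      proof -
        have "2 ^ L dvd Suc n" if "2 ^ lev n dvd Suc n" "\<not> n < N L" for n
        proof -
          have "L \<le> lev n" using that lev_gt[of L n] by simp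
          then show ?thesis using that(1) by (meson dvd_trans le_imp_power_dvd)
        qed
        then have "freq (\<lambda>n. 2 ^ lev n dvd Suc n) M \<le> freq (\<lambda>n. n < N L \<or> 2 ^ L dvd Suc n) M"
          by (intro freq_mono) blast
        then show ?thesis using freq_disj[of "\<lambda>n. n < N L" "\<lambda>n. 2 ^ L dvd Suc n" M] by linarith
      qed
      ultimately show "\<exists>g h a b. (g \<longlonglongrightarrow> a) \<and> (h \<longlonglongrightarrow> b) \<and> 0 - e < a \<and> b < 0 + e \<and>
          (\<forall>\<^sub>F M in sequentially. g M \<le> freq (\<lambda>n. 2 ^ lev n dvd Suc n) M \<and>
            freq (\<lambda>n. 2 ^ lev n dvd Suc n) M \<le> h M)"
        using L \<open>0 < e\<close> freq_nonneg
        by (intro exI[of _ "\<lambda>_. 0"] exI[of _ "0"] exI[of _ "0 + 1 / real (2 ^ L)"]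
            exI[of _ "\<lambda>M. freq (\<lambda>n. n < N L) M + freq (\<lambda>n. 2 ^ L dvd Suc n) M"]
            conjI always_eventually allI tendsto_const) auto
    qed
  qed
  ultimately show thesis by (rule that)
qed

lemma cf_digit_unit_irrationals: "x \<in> unit_irrationals \<Longrightarrow> 1 \<le> cf_digit x"
  by (intro cf_digit_ge_1 unit_irrationals_bounds)

text \<open>If no break occurs during the \<open>2 * k\<close> steps after time \<open>n\<close>,
  then \<open>z n\<close> and the true orbit share \<open>2 * k\<close> digits and differ by at most
  \<open>(1/4) ^ k\<close>. The remaining times precede a break by less than \<open>2 * k\<close>
  and have density zero.\<close>

lemma gauss_distributed_shadow:
  assumes "gauss_distributed z" "\<And>n. z n \<in> unit_irrationals"
    and "zero_density (\<lambda>n. z (Suc n) \<noteq> gauss_map (z n))"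
  shows "gauss_distributed (\<lambda>n. (gauss_map ^^ n) (cf_value (\<lambda>i. cf_digit (z i))))"
proof (rule gauss_distributed_perturb[OF assms(1)])
  fix e :: real assume "0 < e"
  then obtain k where k: "(1/4::real) ^ k < e"
    using real_arch_pow_inv[of e "1/4"] by auto
  define a where "a i = cf_digit (z i)" for i
  have a: "1 \<le> a i" for i
    unfolding a_def by (rule cf_digit_unit_irrationals) fact
  show "zero_density (\<lambda>n. e \<le> \<bar>(gauss_map ^^ n) (cf_value (\<lambda>i. cf_digit (z i))) - z n\<bar>)"
  proof (rule zero_density_mono[OF zero_density_ex_shift[OF assms(3), of "2 * k"]])
    fix n assume n: "e \<le> \<bar>(gauss_map ^^ n) (cf_value (\<lambda>i. cf_digit (z i))) - z n\<bar>"
    show "\<exists>i<2 * k. z (Suc (n + i)) \<noteq> gauss_map (z (n + i))"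
    proof (rule ccontr)
      assume "\<not> ?thesis"
      then have z: "z (n + Suc i) = gauss_map (z (n + i))" if "i < 2 * k" for i
        using that by simp
      define s where "s i = cf_value (\<lambda>j. a (j + (n + i)))" for i
      have "\<bar>s 0 - z (n + 0)\<bar> \<le> (1/4) ^ k"
      proof (rule cf_agree_close[where a = "\<lambda>i. a (n + i)"])
        fix i
        show "s i = 1 / (real (a (n + i)) + s (Suc i))"
          using cf_value_step[of "\<lambda>j. a (j + (n + i))"] a by (simp add: s_def)
        show "0 \<le> s i \<and> s i \<le> 1"
          unfolding s_def using a by (intro cf_value_bounds)
        show "0 \<le> z (n + i) \<and> z (n + i) \<le> 1"
          using unit_irrationals_bounds[OF assms(2)] less_imp_le by blast
        show "1 \<le> a (n + i)" by (rule a)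
        show "z (n + i) = 1 / (real (a (n + i)) + z (n + Suc i))" if "i < 2 * k"
          unfolding z[OF that] a_def by (intro gauss_map_step unit_irrationals_bounds assms(2))
      qed
      moreover have "s 0 = (gauss_map ^^ n) (cf_value (\<lambda>i. cf_digit (z i)))"
        using gauss_map_funpow_cf_value[of a n] a by (simp add: s_def a_def[symmetric])
      ultimately show False using n k by simp
    qed
  qed
qed

subsection \<open>The reduction\<close>

text \<open>The reciprocal of the golden ratio. Being a fixed point of the Gauss map with all digits
  \<open>1\<close>, it fills the overwritten stretches with pieces of a genuine orbit.\<close>

definition golden :: real where
  "golden = cf_value (\<lambda>_. 1)"

lemma golden: "golden \<in> unit_irrationals" "cf_digit golden = 1" "gauss_map golden = golden"
  unfolding golden_def
  by (simp_all add: cf_value_in_unit_irrationals cf_digit_cf_value)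

text \<open>The beginning of the dyadic block \<open>m\<close>, of relative length about
  \<open>1 / (\<alpha> m + 1)\<close>. The product form avoids rounding and already forces
  \<open>n < 2 ^ Suc m\<close>.\<close>

definition overwritten :: "(nat \<Rightarrow> nat) \<Rightarrow> nat \<Rightarrow> bool" where
  "overwritten \<alpha> n \<longleftrightarrow> (\<exists>m. 2 ^ m \<le> n \<and> (n - 2 ^ m) * (\<alpha> m + 1) < 2 ^ m)"

text \<open>\<open>2 ^ m \<le> n\<close> implies \<open>m < n\<close>, so position \<open>n\<close>
  depends on finitely many entries of the sequence. Continuity of the reduction rests on
  this.\<close>

lemma overwritten_cong:
  assumes "\<And>i. i < n \<Longrightarrow> \<alpha> i = \<beta> i"
  shows "overwritten \<alpha> n \<longleftrightarrow> overwritten \<beta> n"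
proof -
  have "\<alpha> m = \<beta> m" if "2 ^ m \<le> n" for m
    using assms[of m] that less_le_trans[OF less_exp] by blast
  then show ?thesis unfolding overwritten_def by auto
qed

lemma overwritten_block:
  assumes "overwritten \<alpha> n" "2 ^ m \<le> n" "n < 2 ^ Suc m"
  shows "(n - 2 ^ m) * (\<alpha> m + 1) < 2 ^ m"
proof -
  obtain l where l: "2 ^ l \<le> n" "(n - 2 ^ l) * (\<alpha> l + 1) < 2 ^ l"
    using assms(1) by (auto simp: overwritten_def)
  have "n - 2 ^ l \<le> (n - 2 ^ l) * (\<alpha> l + 1)" by simp
  then have "n - 2 ^ l < 2 ^ l" using l(2) by (rule le_less_trans)
  then have "n < 2 ^ Suc l" using l(1) by simp
  then have "(2::nat) ^ m < 2 ^ Suc l" "(2::nat) ^ l < 2 ^ Suc m"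
    using assms l by linarith+
  then have "m < Suc l" "l < Suc m" by (simp_all only: power_strict_increasing_iff one_less_numeral_iff semiring_norm)
  then have "m = l" by simp
  then show ?thesis using l by simp
qed

text \<open>Once \<open>\<alpha> m \<ge> k\<close>, block \<open>m\<close> contributes at most
  \<open>2 ^ m / k + 1\<close> positions, and these bounds sum geometrically.\<close>

lemma zero_density_overwritten:
  assumes "filterlim \<alpha> at_top sequentially"
  shows "zero_density (overwritten \<alpha>)"
  unfolding zero_density_def
proof (rule tendsto_squeeze_approx)
  fix e :: real assume "0 < e"
  \<comment> \<open>The limiting bound will be \<open>4 / k\<close>: at most
    \<open>2 * 2 ^ m / k\<close> from the complete blocks before \<open>2 ^ m\<close>, and the same
    from the block containing the current time.\<close>
  obtain k :: nat where k: "4 / e < real k" using reals_Archimedean2 by blast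
  then have k_pos: "0 < real k" using \<open>0 < e\<close> by (meson divide_pos_pos less_trans zero_less_numeral)
  have "\<forall>\<^sub>F m in sequentially. k \<le> \<alpha> m"
    using assms by (simp add: filterlim_at_top)
  then obtain M0 where M0: "\<And>m. M0 \<le> m \<Longrightarrow> k \<le> \<alpha> m"
    by (auto simp: eventually_sequentially)
  \<comment> \<open>For \<open>m > k\<close> one has \<open>2 ^ m / k \<ge> 1\<close>, which absorbs
    the rounding term \<open>1\<close> of each block.\<close>
  define M where "M = max M0 (Suc k)"
  define C where "C n = card {i. i < n \<and> overwritten \<alpha> i}" for n
  have block: "real (C n) \<le> real (C (2 ^ m)) + 2 * 2 ^ m / real k"
    if "M \<le> m" "2 ^ m \<le> n" "n \<le> 2 ^ Suc m" for m n
  proof -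
    have "{i. i < n \<and> overwritten \<alpha> i}
        \<subseteq> {i. i < 2 ^ m \<and> overwritten \<alpha> i} \<union> (\<lambda>d. 2 ^ m + d) ` {..2 ^ m div k}"
    proof
      fix i assume i: "i \<in> {i. i < n \<and> overwritten \<alpha> i}"
      show "i \<in> {i. i < 2 ^ m \<and> overwritten \<alpha> i} \<union> (\<lambda>d. 2 ^ m + d) ` {..2 ^ m div k}"
      proof (cases "i < 2 ^ m")
        case False
        then have "(i - 2 ^ m) * (\<alpha> m + 1) < 2 ^ m"
          using overwritten_block[of \<alpha> i m] i that by auto
        moreover have "(i - 2 ^ m) * k \<le> (i - 2 ^ m) * (\<alpha> m + 1)"
          using M0[of m] that by (intro mult_left_mono) (auto simp: M_def)
        ultimately have "(i - 2 ^ m) * k \<le> 2 ^ m" by linarith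
        then have "i - 2 ^ m \<le> 2 ^ m div k"
          using k_pos by (simp add: less_eq_div_iff_mult_less_eq)
        then show ?thesis using False by (intro UnI2 image_eqI[of _ _ "i - 2 ^ m"]) auto
      qed (use i in simp)
    qed
    then have "C n \<le> card ({i. i < 2 ^ m \<and> overwritten \<alpha> i} \<union> (\<lambda>d. 2 ^ m + d) ` {..2 ^ m div k})"
      unfolding C_def by (intro card_mono) auto
    also have "\<dots> \<le> C (2 ^ m) + card ((\<lambda>d. 2 ^ m + d) ` {..(2::nat) ^ m div k})"
      unfolding C_def by (rule card_Un_le)
    also have "\<dots> \<le> C (2 ^ m) + (2 ^ m div k + 1)"
      using card_image_le[of "{..(2::nat) ^ m div k}" "\<lambda>d. 2 ^ m + d"] by simp
    finally have "real (C n) \<le> real (C (2 ^ m) + (2 ^ m div k + 1))" by (rule of_nat_mono)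
    then have "real (C n) \<le> real (C (2 ^ m)) + (real (2 ^ m div k) + 1)"
      by (simp only: of_nat_add of_nat_1)
    moreover have "real (2 ^ m div k) \<le> 2 ^ m / real k"
      using of_nat_div_le_of_nat[of "2 ^ m" k, where ?'a = real] by simp
    moreover have "1 \<le> 2 ^ m / real k"
    proof -
      have "k \<le> m" using that by (simp add: M_def)
      then have "k \<le> 2 ^ m" using less_exp[of m] by linarith
      then have "real k \<le> 2 ^ m" by (metis of_nat_le_iff of_nat_numeral of_nat_power)
      then show ?thesis using k_pos by simp
    qed
    ultimately show ?thesis by simp
  qed
  have C_pow: "real (C (2 ^ (M + j))) \<le> 2 ^ M + 2 * 2 ^ (M + j) / real k" for j
  proof (induction j)
    case 0
    have "C (2 ^ M) \<le> card {..<(2::nat) ^ M}" unfolding C_def by (intro card_mono) auto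
    then have "real (C (2 ^ M)) \<le> real (2 ^ M)" unfolding of_nat_le_iff by simp
    moreover have "0 \<le> 2 * 2 ^ M / real k" by simp
    ultimately show ?case unfolding add_0_right of_nat_power of_nat_numeral by linarith
  next
    case (Suc j)
    then show ?case using block[of "M + j" "2 ^ Suc (M + j)"] by simp
  qed
  have C_le: "real (C n) \<le> 2 ^ M + 4 * real n / real k" if "2 ^ M \<le> n" for n
  proof -
    have "(1::nat) \<le> 2 ^ M" by simp
    then have "1 \<le> n" using that by (rule le_trans)
    then obtain m where m: "2 ^ m \<le> n" "n < 2 ^ (m + 1)"
      using ex_power_ivl1[of 2 n] by auto
    have "(2::nat) ^ M < 2 ^ (m + 1)" using m that by linarith
    then have "M \<le> m" by (simp only: power_strict_increasing_iff one_less_numeral_iff semiring_norm)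
    then obtain j where j: "m = M + j" using le_Suc_ex by blast
    have "real (C n) \<le> 2 ^ M + 4 * (2 ^ m / real k)"
      using block[of m n] C_pow[of j] \<open>M \<le> m\<close> m by (simp add: j)
    moreover have "2 ^ m / real k \<le> real n / real k"
    proof (rule divide_right_mono)
      show "2 ^ m \<le> real n" using of_nat_mono[OF m(1), where ?'a = real] by simp
    qed simp
    ultimately show ?thesis by simp
  qed
  have "\<forall>\<^sub>F N in sequentially. freq (overwritten \<alpha>) N \<le> 2 ^ M / real N + 4 / real k"
    using eventually_ge_at_top[of "2 ^ M"]
  proof eventually_elim
    case (elim N)
    have "(0::nat) < 2 ^ M" by simp
    then have "0 < N" using elim by linarith
    then show ?case
      using divide_right_mono[OF C_le[OF elim], of "real N"]
      by (simp add: freq_eq_card C_def add_divide_distrib)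
  qed
  moreover have "(\<lambda>N. 2 ^ M / real N + 4 / real k) \<longlonglongrightarrow> 0 + 4 / real k"
    by (intro tendsto_add lim_const_over_n tendsto_const)
  moreover have "4 / real k < e" using k k_pos \<open>0 < e\<close> by (simp add: field_simps)
  ultimately show "\<exists>g h a b. (g \<longlonglongrightarrow> a) \<and> (h \<longlonglongrightarrow> b) \<and> 0 - e < a \<and> b < 0 + e \<and>
      (\<forall>\<^sub>F N in sequentially. g N \<le> freq (overwritten \<alpha>) N \<and> freq (overwritten \<alpha>) N \<le> h N)"
    using \<open>0 < e\<close> freq_nonneg
    by (intro exI[of _ "\<lambda>_. 0"] exI[of _ "0"] exI[of _ "0 + 4 / real k"]
        exI[of _ "\<lambda>N. 2 ^ M / real N + 4 / real k"] conjI tendsto_const) auto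
qed

text \<open>Points rather than digits are replaced, so that the result is again a pseudo-orbit to
  which shadowing applies.\<close>

definition overwrite :: "(nat \<Rightarrow> real) \<Rightarrow> (nat \<Rightarrow> nat) \<Rightarrow> nat \<Rightarrow> real" where
  "overwrite z \<alpha> n = (if overwritten \<alpha> n then golden else z n)"

definition reduction :: "(nat \<Rightarrow> real) \<Rightarrow> (nat \<Rightarrow> nat) \<Rightarrow> real" where
  "reduction z \<alpha> = cf_value (\<lambda>n. cf_digit (overwrite z \<alpha> n))"

lemma overwrite_in_unit_irrationals:
  "(\<And>n. z n \<in> unit_irrationals) \<Longrightarrow> overwrite z \<alpha> n \<in> unit_irrationals"
  by (simp add: overwrite_def golden)

lemma reduction_in_unit_irrationals:
  "(\<And>n. z n \<in> unit_irrationals) \<Longrightarrow> reduction z \<alpha> \<in> unit_irrationals"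
  unfolding reduction_def
  by (intro cf_value_in_unit_irrationals cf_digit_unit_irrationals overwrite_in_unit_irrationals)

text \<open>Continuity of the reduction: the first \<open>2 * k\<close> entries of the sequence
  determine the first \<open>2 * k\<close> digits.\<close>

lemma reduction_close:
  assumes "\<And>n. z n \<in> unit_irrationals" "\<And>i. i < 2 * k \<Longrightarrow> \<alpha> i = \<beta> i"
  shows "\<bar>reduction z \<alpha> - reduction z \<beta>\<bar> \<le> (1/4) ^ k"
  unfolding reduction_def
proof (rule cf_value_close)
  fix i assume "i < 2 * k"
  then have "overwritten \<alpha> i \<longleftrightarrow> overwritten \<beta> i" using assms(2) by (intro overwritten_cong) simp
  then show "cf_digit (overwrite z \<alpha> i) = cf_digit (overwrite z \<beta> i)" by (simp add: overwrite_def)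
qed (intro cf_digit_unit_irrationals overwrite_in_unit_irrationals assms(1))+

text \<open>Overwriting alters \<open>z\<close> only on a set of density zero. A new break at
  \<open>n\<close> requires \<open>n\<close> or \<open>n + 1\<close> to be overwritten, so the
  breaks still have density zero.\<close>

lemma reduction_normal:
  assumes z: "gauss_distributed z" "\<And>n. z n \<in> unit_irrationals"
      "zero_density (\<lambda>n. z (Suc n) \<noteq> gauss_map (z n))"
    and "filterlim \<alpha> at_top sequentially"
  shows "gauss_distributed (\<lambda>n. (gauss_map ^^ n) (reduction z \<alpha>))"
  unfolding reduction_def
proof (rule gauss_distributed_shadow)
  note null = zero_density_overwritten[OF assms(4)]
  show "gauss_distributed (overwrite z \<alpha>)"
  proof (rule gauss_distributed_perturb[OF z(1) zero_density_mono[OF null]])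
    fix e :: real and n assume "0 < e" "e \<le> \<bar>overwrite z \<alpha> n - z n\<bar>"
    then show "overwritten \<alpha> n" by (cases "overwritten \<alpha> n") (auto simp: overwrite_def)
  qed
  show "zero_density (\<lambda>n. overwrite z \<alpha> (Suc n) \<noteq> gauss_map (overwrite z \<alpha> n))"
    using zero_density_disj[OF null zero_density_disj[OF zero_density_shift[OF null, of 1] z(3)]]
    by (rule zero_density_mono) (auto simp: overwrite_def split: if_splits)
qed (intro overwrite_in_unit_irrationals z(2))

text \<open>On a block whose first \<open>2 ^ (m - j)\<close> digits have been overwritten, the orbit avoids
  \<open>(0, 1/2)\<close> for a fixed proportion \<open>1 / 2 ^ j\<close> of the elapsed time.\<close>

lemma reduction_not_normal:
  assumes z: "\<And>n. z n \<in> unit_irrationals"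
    and "\<not> filterlim \<alpha> at_top sequentially"
  shows "\<not> gauss_distributed (\<lambda>n. (gauss_map ^^ n) (reduction z \<alpha>))"
proof
  let ?P = "\<lambda>n. (gauss_map ^^ n) (reduction z \<alpha>) < 1/2"
  assume "gauss_distributed (\<lambda>n. (gauss_map ^^ n) (reduction z \<alpha>))"
  then have lim: "freq ?P \<longlonglongrightarrow> gauss_cdf (1/2)" by (rule gauss_distributedD)
  \<comment> \<open>Failure to tend to infinity leaves a bound \<open>j\<close> below which the
    sequence falls infinitely often.\<close>
  obtain j where j: "\<exists>\<^sub>F m in sequentially. \<alpha> m < j"
    using assms(2) by (auto simp: filterlim_at_top frequently_def not_less)
  define S where "S N = (\<Sum>n<N. of_bool (?P n) :: real)" for N
  have P: "\<not> ?P n" if "overwritten \<alpha> n" for n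
  proof -
    define a where "a i = cf_digit (overwrite z \<alpha> (i + n))" for i
    have a: "1 \<le> a i" for i
      unfolding a_def by (intro cf_digit_unit_irrationals overwrite_in_unit_irrationals z)
    have "(gauss_map ^^ n) (reduction z \<alpha>) = cf_value a"
      unfolding reduction_def a_def
      by (intro gauss_map_funpow_cf_value cf_digit_unit_irrationals overwrite_in_unit_irrationals z)
    also have "\<dots> = 1 / (1 + cf_value (\<lambda>i. a (Suc i)))"
    proof -
      have "a 0 = 1" using that by (simp add: a_def overwrite_def golden)
      moreover have "cf_value a = 1 / (real (a 0) + cf_value (\<lambda>i. a (Suc i)))"
        by (rule cf_value_step) (rule a)
      ultimately show ?thesis by simp
    qed
    also have "\<dots> \<ge> 1 / 2"
      using cf_value_bounds[of "\<lambda>i. a (Suc i)"] a by (intro divide_left_mono) auto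
    finally show ?thesis by simp
  qed
  \<comment> \<open>The second time is \<open>1 + 1 / 2 ^ j\<close> times the first when
    \<open>j \<le> m\<close>. If no visit to the half-line occurs in between,
    \<open>d m = 0\<close>; convergence of the frequencies would instead give \<open>d\<close> the
    positive limit \<open>gauss_cdf (1/2) / 2 ^ j\<close>.\<close>
  define d where "d m = freq ?P (2 ^ m + 2 ^ (m - j)) * (1 + 1 / 2 ^ j) - freq ?P (2 ^ m)" for m
  have "filterlim (\<lambda>m. 2 ^ m :: nat) at_top sequentially"
    by (rule filterlim_at_top_mono[OF filterlim_ident]) (auto intro: always_eventually less_imp_le less_exp)
  then have "filterlim (\<lambda>m. 2 ^ m + 2 ^ (m - j) :: nat) at_top sequentially"
    by (rule filterlim_at_top_mono) (auto intro: always_eventually)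
  then have "d \<longlonglongrightarrow> gauss_cdf (1/2) * (1 + 1 / 2 ^ j) - gauss_cdf (1/2)"
    unfolding d_def
    by (intro tendsto_intros filterlim_compose[OF lim] \<open>filterlim (\<lambda>m. 2 ^ m) at_top sequentially\<close>)
  moreover have "0 < gauss_cdf (1/2) * (1 + 1 / 2 ^ j) - gauss_cdf (1/2)"
  proof -
    have "0 < gauss_cdf (1/2)" by (simp add: gauss_cdf_eq)
    then show ?thesis by (simp add: algebra_simps)
  qed
  ultimately have pos: "\<forall>\<^sub>F m in sequentially. 0 < d m" by (rule order_tendstoD)
  have zero: "d m = 0" if "\<alpha> m < j" "j \<le> m" for m
  proof -
    let ?N = "2 ^ m + 2 ^ (m - j) :: nat"
    have pow: "(2::nat) ^ m = 2 ^ (m - j) * 2 ^ j"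
      using that by (simp add: power_add[symmetric])
    have "overwritten \<alpha> n" if n: "2 ^ m \<le> n" "n < ?N" for n
    proof -
      have "\<alpha> m + 1 \<le> 2 ^ j" using \<open>\<alpha> m < j\<close> less_exp[of j] by linarith
      then have "(n - 2 ^ m) * (\<alpha> m + 1) \<le> (n - 2 ^ m) * 2 ^ j" by (rule mult_left_mono) simp
      also have "\<dots> < 2 ^ (m - j) * 2 ^ j" using n by (intro mult_strict_right_mono) auto
      finally have "(n - 2 ^ m) * (\<alpha> m + 1) < 2 ^ m" unfolding pow[symmetric] .
      with n(1) show ?thesis unfolding overwritten_def by blast
    qed
    then have "(\<Sum>n=2 ^ m..<?N. of_bool (?P n)) = (0::real)"
      using P by (intro sum.neutral) auto
    then have "S ?N = S (2 ^ m)"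
      using sum.atLeastLessThan_concat[of 0 "2 ^ m" ?N "\<lambda>n. of_bool (?P n) :: real"]
      unfolding S_def lessThan_atLeast0 by simp
    moreover have "real ?N = 2 ^ m * (1 + 1 / 2 ^ j)"
      using arg_cong[OF pow, of real] by (simp add: field_simps)
    ultimately have "freq ?P ?N = S (2 ^ m) / (2 ^ m * (1 + 1 / 2 ^ j))"
      by (simp only: freq_def S_def)
    moreover have "freq ?P (2 ^ m) = S (2 ^ m) / 2 ^ m"
      by (simp only: freq_def S_def of_nat_power of_nat_numeral)
    moreover have "1 + 1 / 2 ^ j \<noteq> (0::real)"
      by (intro less_imp_neq[symmetric] add_pos_pos) simp_all
    ultimately show ?thesis
      unfolding d_def by (simp only: divide_divide_eq_left[symmetric] nonzero_divide_eq_eq[symmetric]) simp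
  qed
  have "\<exists>\<^sub>F m in sequentially. \<alpha> m < j \<and> (0 < d m \<and> j \<le> m)"
    using j eventually_conj[OF pos eventually_ge_at_top[of j]] by (rule frequently_eventually_frequently)
  then show False using zero by (auto dest!: frequently_ex)
qed

subsection \<open>Sequences tending to infinity\<close>

text \<open>Agreement of prefixes describes the basic neighbourhoods of Baire space.\<close>

definition agree :: "nat \<Rightarrow> (nat \<Rightarrow> nat) \<Rightarrow> (nat \<Rightarrow> nat) \<Rightarrow> bool" where
  "agree l \<alpha> \<beta> \<longleftrightarrow> (\<forall>i<l. \<alpha> i = \<beta> i)"

lemma agree_limit:
  assumes "\<And>m. agree (l m) (a m) (a (Suc m))" "\<And>m. l m < l (Suc m)"
  obtains b where "\<And>m. agree (l m) (a m) b"
proof -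
  have mono: "strict_mono l" using assms(2) by (simp add: strict_mono_Suc_iff)
  have agree: "a m i = a (m + k) i" if "i < l m" for m k i
  proof (induction k)
    case (Suc k)
    have "l m \<le> l (m + k)" using mono by (simp add: strict_mono_less_eq)
    then show ?case using Suc assms(1)[of "m + k"] that by (simp add: agree_def)
  qed simp
  show thesis
  \<comment> \<open>As \<open>l\<close> is strictly increasing, \<open>i < l (Suc i)\<close>, so
    entry \<open>i\<close> is settled from stage \<open>Suc i\<close> on.\<close>
  proof (rule that[of "\<lambda>i. a (Suc i) i"])
    fix m
    have "a m i = a (Suc i) i" if "i < l m" for i
    proof (cases "m \<le> Suc i")
      case True
      then show ?thesis using agree[OF that, of "Suc i - m"] by simp
    next
      case False
      have "i < l (Suc i)" using strict_mono_imp_increasing[OF mono, of "Suc i"] by simp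
      then show ?thesis using agree[of i "Suc i" "m - Suc i"] False by simp
    qed
    then show "agree (l m) (a m) (\<lambda>i. a (Suc i) i)" by (simp add: agree_def)
  qed
qed

text \<open>A closed subset of Baire space, hence open to category arguments. Raising
  \<open>k\<close> along nested cones forces the limit to infinity, while a fixed \<open>k\<close>
  still lets the value \<open>k\<close> recur.\<close>

definition cone :: "nat \<Rightarrow> nat \<Rightarrow> (nat \<Rightarrow> nat) \<Rightarrow> (nat \<Rightarrow> nat) set" where
  "cone k l \<alpha> = {\<beta>. agree l \<alpha> \<beta> \<and> (\<forall>i\<ge>l. k \<le> \<beta> i)}"

text \<open>A \<open>G\<^sub>\<delta>\<close> set inside the set of sequences tending to infinity is not dense in any cone, since
  both it and the set of sequences taking the value \<open>k\<close> infinitely often would be residual there.\<close>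

lemma cone_avoiding_G_delta:
  assumes opn: "\<And>m \<alpha>. \<alpha> \<in> V m \<Longrightarrow> \<exists>l. \<forall>\<beta>. agree l \<alpha> \<beta> \<longrightarrow> \<beta> \<in> V m"
    and sub: "\<And>\<alpha>. (\<And>m::nat. \<alpha> \<in> V m) \<Longrightarrow> filterlim \<alpha> at_top sequentially"
  shows "\<exists>\<beta> l'. \<beta> \<in> cone k l \<alpha> \<and> l < l' \<and> cone k l' \<beta> \<inter> (\<Inter>m. V m) = {}"
proof (rule ccontr)
  assume not: "\<not> ?thesis"
  have dense: "\<exists>\<gamma>. \<gamma> \<in> cone k l' \<beta> \<and> (\<forall>m. \<gamma> \<in> V m)"
    if "\<beta> \<in> cone k l \<alpha>" "l < l'" for \<beta> l'
  proof -
    have "cone k l' \<beta> \<inter> (\<Inter>m. V m) \<noteq> {}" using not that by simp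
    then show ?thesis by auto
  qed
  define inv where "inv s \<longleftrightarrow> fst s \<in> cone k l \<alpha> \<and> l < snd s" for s :: "(nat \<Rightarrow> nat) \<times> nat"
  \<comment> \<open>Stage \<open>m\<close> secures membership in \<open>V m\<close> and puts the
    value \<open>k\<close> at the end of the new prefix. The limit then lies in every
    \<open>V m\<close>, yet takes the value \<open>k\<close> infinitely often.\<close>
  define next_to where "next_to m s t \<longleftrightarrow> agree (snd s) (fst s) (fst t) \<and> snd s < snd t \<and>
      fst t (snd t - 1) = k \<and> (\<forall>\<beta>. agree (snd t) (fst t) \<beta> \<longrightarrow> \<beta> \<in> V m)"
    for m and s t :: "(nat \<Rightarrow> nat) \<times> nat"
  have "\<exists>s. inv s"
    by (rule exI[of _ "(\<lambda>i. if i < l then \<alpha> i else k, Suc l)"]) (simp add: inv_def cone_def agree_def)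
  moreover have "\<exists>t. inv t \<and> next_to m s t" if s: "inv s" for s m
  proof -
    obtain \<beta> p where [simp]: "s = (\<beta>, p)" by (cases s)
    have \<beta>: "\<beta> \<in> cone k l \<alpha>" "l < p" using s by (auto simp: inv_def)
    obtain \<gamma> where \<gamma>: "\<gamma> \<in> cone k p \<beta>" "\<And>m. \<gamma> \<in> V m"
      using dense[OF \<beta>] by blast
    obtain r where r: "\<And>\<delta>. agree r \<gamma> \<delta> \<Longrightarrow> \<delta> \<in> V m"
      using opn[OF \<gamma>(2)] by blast
    \<comment> \<open>Changing entry \<open>q \<ge> r\<close> leaves the prefix that guarantees
      membership in \<open>V m\<close> intact, and the new value \<open>k\<close> is still allowed
      in the cone.\<close>
    define q where "q = max p r"
    let ?t = "(\<gamma>(q := k), Suc q)"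
    have "\<gamma> i = \<beta> i" if "i < p" for i using \<gamma>(1) that by (simp add: cone_def agree_def)
    then have "inv ?t"
      using \<beta> \<gamma>(1) unfolding inv_def cone_def agree_def q_def
      by (auto simp: not_less max_def) (metis not_le)+
    moreover have "next_to m s ?t"
      using \<gamma>(1) r unfolding next_to_def cone_def agree_def q_def by auto
    ultimately show ?thesis by blast
  qed
  ultimately obtain f where f: "\<And>m. inv (f m)" "\<And>m. next_to m (f m) (f (Suc m))"
    using dependent_nat_choice[of "\<lambda>_. inv" next_to] by metis
  obtain b where b: "\<And>m. agree (snd (f m)) (fst (f m)) b"
    using agree_limit[of "\<lambda>m. snd (f m)" "\<lambda>m. fst (f m)"] f(2) unfolding next_to_def by blast
  have "b \<in> V m" for m
    using f(2)[of m] b[of "Suc m"] by (simp add: next_to_def)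
  then have "filterlim b at_top sequentially" by (rule sub)
  then have "\<forall>\<^sub>F i in sequentially. Suc k \<le> b i" by (simp add: filterlim_at_top)
  then obtain n where n: "\<And>i. n \<le> i \<Longrightarrow> Suc k \<le> b i" by (auto simp: eventually_sequentially)
  have "strict_mono (\<lambda>m. snd (f m))"
    using f(2) by (simp add: strict_mono_Suc_iff next_to_def)
  then have "n \<le> snd (f n)" by (rule strict_mono_imp_increasing)
  moreover have "snd (f n) < snd (f (Suc n))" "fst (f (Suc n)) (snd (f (Suc n)) - 1) = k"
    using f(2)[of n] by (auto simp: next_to_def)
  moreover have "b (snd (f (Suc n)) - 1) = fst (f (Suc n)) (snd (f (Suc n)) - 1)"
    using b[of "Suc n"] \<open>snd (f n) < snd (f (Suc n))\<close> by (simp add: agree_def)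
  ultimately have "n \<le> snd (f (Suc n)) - 1" "b (snd (f (Suc n)) - 1) = k" by linarith+
  then show False using n[of "snd (f (Suc n)) - 1"] by simp
qed

text \<open>Nested cones are chosen so that the \<open>n\<close>-th choice avoids the
  \<open>n\<close>-th intersection and keeps the new entries at least \<open>n\<close>. Their limit
  tends to infinity but lies in none of the intersections.\<close>

lemma at_top_not_Sigma3:
  fixes V :: "nat \<Rightarrow> nat \<Rightarrow> (nat \<Rightarrow> nat) set"
  assumes opn: "\<And>n m \<alpha>. \<alpha> \<in> V n m \<Longrightarrow> \<exists>l. \<forall>\<beta>. agree l \<alpha> \<beta> \<longrightarrow> \<beta> \<in> V n m"
  shows "{\<alpha>. filterlim \<alpha> at_top sequentially} \<noteq> (\<Union>n. \<Inter>m. V n m)"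
proof
  assume eq: "{\<alpha>. filterlim \<alpha> at_top sequentially} = (\<Union>n. \<Inter>m. V n m)"
  define next_to where "next_to n s t \<longleftrightarrow> fst t \<in> cone n (snd s) (fst s) \<and> snd s < snd t \<and>
      cone n (snd t) (fst t) \<inter> (\<Inter>m. V n m) = {}" for n and s t :: "(nat \<Rightarrow> nat) \<times> nat"
  have "\<exists>t. next_to n s t" for n s
  proof -
    have "filterlim \<alpha> at_top sequentially" if "\<And>m. \<alpha> \<in> V n m" for \<alpha>
      using eq that by blast
    then obtain \<beta> l' where "\<beta> \<in> cone n (snd s) (fst s)" "snd s < l'" "cone n l' \<beta> \<inter> (\<Inter>m. V n m) = {}"
      using cone_avoiding_G_delta[of "V n" n "snd s" "fst s", OF opn] by blast
    then show ?thesis by (intro exI[of _ "(\<beta>, l')"]) (simp add: next_to_def)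
  qed
  then obtain f where f: "\<And>n. next_to n (f n) (f (Suc n))"
    using dependent_nat_choice[of "\<lambda>_ _. True" next_to] by auto
  obtain b where b: "\<And>m. agree (snd (f m)) (fst (f m)) b"
    using agree_limit[of "\<lambda>m. snd (f m)" "\<lambda>m. fst (f m)"] f unfolding next_to_def cone_def by blast
  have mono: "strict_mono (\<lambda>m. snd (f m))"
    using f by (simp add: strict_mono_Suc_iff next_to_def)
  \<comment> \<open>Later stages either keep an entry or choose it anew above a higher floor, so the
    bound \<open>n\<close> persists.\<close>
  have ge: "n \<le> fst (f (Suc n + j)) i" if "snd (f n) \<le> i" for n j i
  proof (induction j)
    case 0
    then show ?case using f[of n] that by (simp add: next_to_def cone_def)
  next
    case (Suc j)
    show ?case
    proof (cases "i < snd (f (Suc n + j))")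
      case True
      then show ?thesis using f[of "Suc n + j"] Suc by (simp add: next_to_def cone_def agree_def)
    next
      case False
      then have "Suc n + j \<le> fst (f (Suc (Suc n + j))) i"
        using f[of "Suc n + j"] by (simp add: next_to_def cone_def)
      then show ?thesis by simp
    qed
  qed
  have b_ge: "n \<le> b i" if "snd (f n) \<le> i" for n i
  proof -
    have "i < snd (f (Suc n + i))"
      using strict_mono_imp_increasing[OF mono, of "Suc n + i"] by simp
    then have "b i = fst (f (Suc n + i)) i" using b[of "Suc n + i"] by (simp add: agree_def)
    then show ?thesis using ge[OF that, of i] by simp
  qed
  have "filterlim b at_top sequentially"
    unfolding filterlim_at_top eventually_sequentially using b_ge by blast
  then obtain n where n: "b \<in> (\<Inter>m. V n m)" using eq by blast
  have "snd (f n) < snd (f (Suc n))" using f[of n] by (simp add: next_to_def)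
  then have "b \<in> cone n (snd (f (Suc n))) (fst (f (Suc n)))"
    using b[of "Suc n"] b_ge[of n] by (simp add: cone_def)
  then show False using n f[of n] by (auto simp: next_to_def)
qed

subsection \<open>Borel complexity of the set of normal points\<close>

text \<open>The two inclusions treat all kinds of intervals at once: \<open>I\<close> differs from
  \<open>{a..b}\<close> at most in the endpoints, a null set.\<close>

lemma gauss_measure_interval:
  assumes "0 \<le> a" "a \<le> b" "b \<le> 1" "{a<..<b} \<subseteq> I" "I \<subseteq> {a..b}"
  shows "gauss_measure I = gauss_cdf b - gauss_cdf a"
proof -
  have in_I: "x \<in> I \<longleftrightarrow> x \<in> {a<..<b} \<or> x \<in> I \<inter> {a, b}" for x
  proof
    assume x: "x \<in> I"
    then have "x \<in> {a..b}" using assms(5) by (rule subsetD[rotated])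
    then have "x \<in> {a<..<b} \<or> x \<in> {a, b}" by fastforce
    then show "x \<in> {a<..<b} \<or> x \<in> I \<inter> {a, b}" using x by blast
  qed (use assms(4) in blast)
  then have "{a<..<b} \<union> (I \<inter> {a, b}) = I" by blast
  moreover have "{a<..<b} \<union> (I \<inter> {a, b}) \<in> sets borel"
    by (intro sets.Un borel_open open_greaterThanLessThan borel_closed finite_imp_closed) simp
  ultimately have I: "I \<in> sets borel" by simp
  have "(LINT x:{0..1}|lborel. indicator I x / (1 + x))
      = (\<integral>x. (1 / (1 + x)) * indicator {a..b} x \<partial>lborel)"
    unfolding set_lebesgue_integral_def
  proof (rule integral_cong_AE)
    show "AE x in lborel. indicator {0..1} x *\<^sub>R (indicator I x / (1 + x)) = 1 / (1 + x) * indicator {a..b} x"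
      using AE_lborel_singleton[of a] AE_lborel_singleton[of b]
    proof eventually_elim
      case (elim x)
      then have "x \<in> I \<longleftrightarrow> x \<in> {a..b}" using in_I[of x] by auto
      then show ?case using assms by (auto simp: indicator_def)
    qed
  qed (use I in measurable)
  also have "\<dots> = ln (1 + b) - ln (1 + a)"
  proof (rule integral_FTC_Icc_real[OF assms(2)])
    fix x assume "a \<le> x" "x \<le> b"
    then have "0 \<le> x" using assms by simp
    then show "DERIV (\<lambda>x. ln (1 + x)) x :> 1 / (1 + x)" "isCont (\<lambda>x. 1 / (1 + x)) x"
      by (auto intro!: derivative_eq_intros continuous_intros)
  qed
  finally show ?thesis
    using assms by (simp add: gauss_measure_def gauss_cdf_eq diff_divide_distrib)
qed

lemma interval_endpoints:
  assumes "is_interval I" "I \<subseteq> {0..1::real}"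
  obtains a b where "0 \<le> a" "a \<le> b" "b \<le> 1" "{a<..<b} \<subseteq> I" "I \<subseteq> {a..b}"
proof (cases "I = {}")
  case True
  \<comment> \<open>The empty set also counts as an interval; it fits the degenerate endpoints
    \<open>0\<close> and \<open>0\<close>.\<close>
  then show ?thesis using that[of 0 0] by simp
next
  case False
  have bdd: "bdd_below I" "bdd_above I"
    using assms(2) by (meson bdd_below_Icc bdd_below_mono bdd_above_Icc bdd_above_mono)+
  show ?thesis
  proof (rule that[of "Inf I" "Sup I"])
    show "0 \<le> Inf I" using False assms(2) by (intro cInf_greatest) auto
    show "Sup I \<le> 1" using False assms(2) by (intro cSup_least) auto
    show "Inf I \<le> Sup I" using False bdd(2,1) by (rule cInf_le_cSup)
    show "I \<subseteq> {Inf I..Sup I}" using bdd by (auto intro: cInf_lower cSup_upper)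
    show "{Inf I<..<Sup I} \<subseteq> I"
    proof
      fix x assume "x \<in> {Inf I<..<Sup I}"
      then obtain y z where "y \<in> I" "y < x" "z \<in> I" "x < z"
        using False bdd by (auto simp: cInf_less_iff less_cSup_iff)
      then show "x \<in> I"
        using assms(1) unfolding is_interval_1 by (meson less_imp_le)
    qed
  qed
qed

text \<open>Forward, only the intervals \<open>{0..<c}\<close> are tested. Backward, an arbitrary
  interval lies between an open and a closed one with the same endpoints, whose frequencies have the
  same limit.\<close>

lemma cf_normal_iff_gauss_distributed:
  assumes "x \<in> unit_irrationals"
  shows "cf_normal x \<longleftrightarrow> gauss_distributed (\<lambda>n. (gauss_map ^^ n) x)"
proof
  assume normal: "cf_normal x"
  note bounds = unit_irrationals_bounds[OF gauss_map_funpow_closed[OF assms]]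
  show "gauss_distributed (\<lambda>n. (gauss_map ^^ n) x)"
    unfolding gauss_distributed_def
  proof
    fix q :: real
    define c where "c = max 0 (min 1 q)"
    have c: "0 \<le> c" "c \<le> 1" by (auto simp: c_def)
    then have "is_interval {0..<c}" "{0..<c} \<subseteq> {0..1}"
      by (auto simp: is_interval_1)
    then have "freq (\<lambda>n. (gauss_map ^^ n) x \<in> {0..<c}) \<longlonglongrightarrow> gauss_measure {0..<c}"
      using normal unfolding cf_normal_def freq_eq_card[abs_def] by blast
    moreover have "gauss_measure {0..<c} = gauss_cdf q"
      using c by (subst gauss_measure_interval[of 0 c]) (auto simp: gauss_cdf_def c_def)
    moreover have "(gauss_map ^^ n) x \<in> {0..<c} \<longleftrightarrow> (gauss_map ^^ n) x < q" for n
      using bounds[of n] by (auto simp: c_def)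
    ultimately show "freq (\<lambda>n. (gauss_map ^^ n) x < q) \<longlonglongrightarrow> gauss_cdf q" by simp
  qed
next
  assume gd: "gauss_distributed (\<lambda>n. (gauss_map ^^ n) x)"
  show "cf_normal x"
    unfolding cf_normal_def freq_eq_card[symmetric]
  proof (intro allI impI)
    fix I :: "real set" assume "is_interval I \<and> I \<subseteq> {0..1}"
    then obtain a b where ab: "0 \<le> a" "a \<le> b" "b \<le> 1" "{a<..<b} \<subseteq> I" "I \<subseteq> {a..b}"
      using interval_endpoints by metis
    show "freq (\<lambda>n. (gauss_map ^^ n) x \<in> I) \<longlonglongrightarrow> gauss_measure I"
      unfolding gauss_measure_interval[OF ab]
    proof (rule tendsto_sandwich[OF _ _ gauss_distributed_between[OF gd ab(2)]])
      show "\<forall>\<^sub>F N in sequentially. freq (\<lambda>n. a < (gauss_map ^^ n) x \<and> (gauss_map ^^ n) x < b) N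
          \<le> freq (\<lambda>n. (gauss_map ^^ n) x \<in> I) N"
        using ab(4) by (intro always_eventually allI freq_mono) auto
      show "\<forall>\<^sub>F N in sequentially. freq (\<lambda>n. (gauss_map ^^ n) x \<in> I) N
          \<le> freq (\<lambda>n. a \<le> (gauss_map ^^ n) x \<and> (gauss_map ^^ n) x \<le> b) N"
        using ab(5) by (intro always_eventually allI freq_mono) auto
    qed
  qed
qed

section \<open>Continuity of finite-time frequencies\<close>

text \<open>The floor function jumps only at integers, and \<open>1 / x\<close> is
  irrational.\<close>

lemma continuous_on_gauss_map: "continuous_on unit_irrationals gauss_map"
  unfolding gauss_map_def[abs_def] continuous_on_def
proof
  fix x assume x: "x \<in> unit_irrationals"
  have "1 / x \<notin> \<int>"
  proof
    assume "1 / x \<in> \<int>"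
    then have "1 / (1 / x) \<in> \<rat>" by (meson Ints_subset_Rats Rats_1 Rats_divide subsetD)
    then show False using x by (simp add: unit_irrationals_def)
  qed
  moreover have "((\<lambda>y. 1 / y) \<longlongrightarrow> 1 / x) (at x within unit_irrationals)"
    using unit_irrationals_bounds(1)[OF x] by (intro tendsto_intros) auto
  ultimately show "((\<lambda>y. 1 / y - of_int \<lfloor>1 / y\<rfloor>) \<longlongrightarrow> 1 / x - of_int \<lfloor>1 / x\<rfloor>)
      (at x within unit_irrationals)"
    by (intro tendsto_diff tendsto_of_int_floor)
qed

lemma continuous_on_gauss_map_funpow: "continuous_on unit_irrationals (gauss_map ^^ n)"
proof (induction n)
  case (Suc n)
  have "continuous_on unit_irrationals (gauss_map \<circ> (gauss_map ^^ n))"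
    by (rule continuous_on_compose[OF Suc continuous_on_subset[OF continuous_on_gauss_map]])
      (auto intro: gauss_map_funpow_closed)
  then show ?case by simp
qed (simp add: continuous_on_id)

text \<open>An irrational orbit never meets a rational threshold, so each indicator is locally
  constant on \<open>unit_irrationals\<close>.\<close>

lemma continuous_on_freq_gauss_map:
  "continuous_on unit_irrationals (\<lambda>x. freq (\<lambda>n. (gauss_map ^^ n) x < real_of_rat q) N)"
proof -
  let ?q = "real_of_rat q"
  have step: "continuous_on unit_irrationals (\<lambda>y. of_bool (y < ?q) :: real)"
    unfolding continuous_on_def
  proof
    fix y assume "y \<in> unit_irrationals"
    then have "y \<noteq> ?q" by (auto simp: unit_irrationals_def)
    then consider "y < ?q" | "?q < y" by linarith
    then have "\<forall>\<^sub>F t in at y within unit_irrationals. of_bool (t < ?q) = (of_bool (y < ?q) :: real)"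
    proof cases
      case 1
      from order_tendstoD(2)[OF tendsto_ident_at 1] show ?thesis
        by (rule eventually_mono) (use 1 in simp)
    next
      case 2
      from order_tendstoD(1)[OF tendsto_ident_at 2] show ?thesis
        by (rule eventually_mono) (use 2 in simp)
    qed
    then show "((\<lambda>t. of_bool (t < ?q) :: real) \<longlongrightarrow> of_bool (y < ?q)) (at y within unit_irrationals)"
      by (rule tendsto_eventually)
  qed
  have "continuous_on unit_irrationals (\<lambda>x. of_bool ((gauss_map ^^ n) x < ?q) :: real)" for n
    by (rule continuous_on_compose2[OF step continuous_on_gauss_map_funpow])
      (auto intro: gauss_map_funpow_closed)
  then show ?thesis
    unfolding freq_def divide_inverse by (intro continuous_intros)
qed

section \<open>Low Borel levels in explicit form\<close>

lemma Pi0_1: "A \<in> Pi0 X (Suc 0) \<longleftrightarrow> closedin X A"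
proof
  assume "A \<in> Pi0 X (Suc 0)"
  then show "closedin X A" by auto
next
  assume "closedin X A"
  then have "openin X (topspace X - A)" "A = topspace X - (topspace X - A)"
    using closedin_subset by (auto simp: closedin_def)
  then show "A \<in> Pi0 X (Suc 0)" by auto
qed

lemma Pi0_2I:
  assumes "\<And>n::nat. closedin X (D n)" "A = topspace X - (\<Union>n. D n)"
  shows "A \<in> Pi0 X (Suc (Suc 0))"
proof -
  have "range D \<subseteq> Pi0 X (Suc 0)" using assms(1) Pi0_1 by blast
  then have "(\<Union>n. D n) \<in> Sigma0 X (Suc (Suc 0))"
    unfolding Sigma0.simps by (intro CollectI exI[of _ "range D"]) simp
  then show ?thesis unfolding Pi0.simps(1) assms(2) by blast
qed

lemma Pi0_2E:
  assumes "A \<in> Pi0 (top_of_set S) (Suc (Suc 0))"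
  obtains W :: "nat \<Rightarrow> 'a::topological_space set" where "\<And>m. open (W m)" "A = S \<inter> (\<Inter>m. W m)"
proof -
  obtain \<D> where \<D>: "countable \<D>" "\<D> \<subseteq> Pi0 (top_of_set S) (Suc 0)" "A = S - \<Union>\<D>"
    using assms by auto
  \<comment> \<open>Inserting the empty set leaves the union unchanged and makes the family
    nonempty, so that it can be enumerated.\<close>
  define E where "E = from_nat_into (insert {} \<D>)"
  have ran: "range E = insert {} \<D>"
    unfolding E_def using \<D>(1) by (intro range_from_nat_into) auto
  have "\<exists>W. open W \<and> S - E m = S \<inter> W" for m
  proof -
    have "E m \<in> insert {} \<D>" using ran by blast
    then have "closedin (top_of_set S) (E m)"
      using \<D>(2) unfolding Pi0_1[symmetric] by (auto simp del: Pi0.simps simp: Pi0_1)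
    then have "openin (top_of_set S) (S - E m)" by (simp add: closedin_def)
    then show ?thesis by (auto simp: openin_open)
  qed
  then obtain W where W: "\<And>m. open (W m)" "\<And>m. S - E m = S \<inter> W m" by metis
  have "\<Union>\<D> = (\<Union>m. E m)" using ran by auto
  then have "A = (\<Inter>m. S - E m)" using \<D>(3) by auto
  also have "\<dots> = S \<inter> (\<Inter>m. W m)" unfolding W(2) by auto
  finally show thesis using W(1) by (intro that)
qed

section \<open>The two complexity bounds\<close>

text \<open>Normality says that for all \<open>q\<close> and \<open>k\<close> there is
  \<open>M\<close> such that all \<open>N \<ge> M\<close> satisfy \<open>C q k N x\<close>. The weak
  inequality in \<open>C\<close> makes this condition closed in \<open>x\<close>, so the set is a
  countable intersection of countable unions of closed sets.\<close>

lemma cf_normal_in_Pi0_3: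
  "{x \<in> unit_irrationals. cf_normal x} \<in> Pi0 (top_of_set unit_irrationals) 3"
proof -
  let ?X = "top_of_set unit_irrationals"
  define C where "C q k N x \<longleftrightarrow>
      \<bar>freq (\<lambda>n. (gauss_map ^^ n) x < real_of_rat q) N - gauss_cdf (real_of_rat q)\<bar> \<le> 1 / real (Suc k)"
    for q k N x
  have normal: "cf_normal x \<longleftrightarrow> (\<forall>q k. \<exists>M. \<forall>N\<ge>M. C q k N x)" if x: "x \<in> unit_irrationals" for x
  proof -
    have "gauss_distributed (\<lambda>n. (gauss_map ^^ n) x) \<longleftrightarrow> (\<forall>q. freq (\<lambda>n. (gauss_map ^^ n) x < real_of_rat q)
        \<longlonglongrightarrow> gauss_cdf (real_of_rat q))"
    proof
      assume "gauss_distributed (\<lambda>n. (gauss_map ^^ n) x)"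
      then show "\<forall>q. freq (\<lambda>n. (gauss_map ^^ n) x < real_of_rat q) \<longlonglongrightarrow> gauss_cdf (real_of_rat q)"
        by (intro allI gauss_distributedD)
    next
      assume "\<forall>q. freq (\<lambda>n. (gauss_map ^^ n) x < real_of_rat q) \<longlonglongrightarrow> gauss_cdf (real_of_rat q)"
      then show "gauss_distributed (\<lambda>n. (gauss_map ^^ n) x)"
        by (intro gauss_distributed_dense) (rule spec)
    qed
    also have "\<dots> \<longleftrightarrow> (\<forall>q k. \<exists>M. \<forall>N\<ge>M. C q k N x)"
    proof (intro iff_allI iffI allI)
      fix q k assume "freq (\<lambda>n. (gauss_map ^^ n) x < real_of_rat q) \<longlonglongrightarrow> gauss_cdf (real_of_rat q)"
      then have "\<forall>\<^sub>F N in sequentially. dist (freq (\<lambda>n. (gauss_map ^^ n) x < real_of_rat q) N)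
          (gauss_cdf (real_of_rat q)) < 1 / real (Suc k)"
        by (rule tendstoD) simp
      then have "\<forall>\<^sub>F N in sequentially. C q k N x"
        by eventually_elim (simp add: C_def dist_real_def)
      then show "\<exists>M. \<forall>N\<ge>M. C q k N x" by (simp add: eventually_sequentially)
    next
      fix q assume *: "\<forall>k. \<exists>M. \<forall>N\<ge>M. C q k N x"
      show "freq (\<lambda>n. (gauss_map ^^ n) x < real_of_rat q) \<longlonglongrightarrow> gauss_cdf (real_of_rat q)"
      proof (rule tendstoI)
        fix e :: real assume "0 < e"
        then obtain k where k: "1 / real (Suc k) < e" by (rule nat_approx_posE)
        have "\<forall>\<^sub>F N in sequentially. C q k N x" using * by (simp add: eventually_sequentially)
        then show "\<forall>\<^sub>F N in sequentially. dist (freq (\<lambda>n. (gauss_map ^^ n) x < real_of_rat q) N)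
            (gauss_cdf (real_of_rat q)) < e"
        proof eventually_elim
          case (elim N)
          then show ?case using k by (simp add: C_def dist_real_def)
        qed
      qed
    qed
    finally show ?thesis by (simp add: cf_normal_iff_gauss_distributed[OF x])
  qed
  define D where "D q k M = {x \<in> unit_irrationals. \<forall>N\<ge>M. C q k N x}" for q k M
  \<comment> \<open>The complement of one such union. The non-normal points are the union of these
    countably many sets, which has the form required of \<open>Sigma0\<close> at level 3.\<close>
  define B where "B = (\<lambda>(q, k). unit_irrationals - (\<Union>M. D q k M))"
  have "closedin ?X (D q k M)" for q k M
  proof -
    have "closedin ?X (unit_irrationals \<inter> (\<lambda>x. freq (\<lambda>n. (gauss_map ^^ n) x < real_of_rat q) N)
        -` cball (gauss_cdf (real_of_rat q)) (1 / real (Suc k)))" for N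
      by (intro continuous_closedin_preimage continuous_on_freq_gauss_map closed_cball)
    then have "closedin ?X (\<Inter>N\<in>{M..}. unit_irrationals \<inter> (\<lambda>x. freq (\<lambda>n. (gauss_map ^^ n) x < real_of_rat q) N)
        -` cball (gauss_cdf (real_of_rat q)) (1 / real (Suc k)))"
      by (intro closedin_INT) auto
    also have "\<dots> = D q k M"
      by (auto simp: D_def C_def dist_real_def abs_minus_commute)
    finally show ?thesis .
  qed
  then have "B qk \<in> Pi0 ?X (Suc (Suc 0))" for qk
    by (cases qk, rule Pi0_2I[of _ "D (fst qk) (snd qk)"]) (simp_all add: B_def)
  then have "(\<Union>qk. B qk) \<in> Sigma0 ?X (Suc (Suc (Suc 0)))"
    unfolding Sigma0.simps by (intro CollectI exI[of _ "range B"]) auto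
  then have "topspace ?X - (\<Union>qk. B qk) \<in> Pi0 ?X 3"
    unfolding Pi0.simps(1) numeral_3_eq_3 by blast
  also have "topspace ?X - (\<Union>qk. B qk) = {x \<in> unit_irrationals. cf_normal x}"
    by (auto simp: B_def D_def normal)
  finally show ?thesis .
qed

text \<open>A countable union of \<open>G_delta\<close> sets would pull back along the continuous
  reduction to a representation of the same kind for the sequences tending to infinity.\<close>

lemma cf_normal_not_in_Sigma0_3:
  "{x \<in> unit_irrationals. cf_normal x} \<notin> Sigma0 (top_of_set unit_irrationals) 3"
proof
  let ?A = "{x \<in> unit_irrationals. cf_normal x}"
  assume "?A \<in> Sigma0 (top_of_set unit_irrationals) 3"
  then obtain \<C> where \<C>: "countable \<C>" "\<C> \<subseteq> Pi0 (top_of_set unit_irrationals) (Suc (Suc 0))" "?A = \<Union>\<C>"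
    unfolding numeral_3_eq_3 Sigma0.simps by blast
  obtain z where z: "gauss_distributed z" "\<And>n. z n \<in> unit_irrationals"
      "zero_density (\<lambda>n. z (Suc n) \<noteq> gauss_map (z n))"
    using exists_gauss_distributed_pseudo_orbit by blast
  note irr = reduction_in_unit_irrationals[of z, OF z(2)]
  have red: "reduction z \<alpha> \<in> ?A \<longleftrightarrow> filterlim \<alpha> at_top sequentially" for \<alpha>
    using reduction_normal[of z \<alpha>, OF z] reduction_not_normal[of z \<alpha>, OF z(2)] irr[of \<alpha>]
      cf_normal_iff_gauss_distributed[OF irr, of \<alpha>] by blast
  \<comment> \<open>One sequence tending to infinity shows that the family is nonempty, as its
    enumeration requires.\<close>
  have "filterlim (\<lambda>n::nat. n) at_top sequentially" by (rule filterlim_ident)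
  then have "reduction z (\<lambda>n. n) \<in> \<Union>\<C>" unfolding red[symmetric] \<C>(3) .
  then have "\<C> \<noteq> {}" by blast
  define B where "B = from_nat_into \<C>"
  have ran: "range B = \<C>"
    unfolding B_def by (rule range_from_nat_into) fact+
  have "\<exists>W :: nat \<Rightarrow> real set. (\<forall>m. open (W m)) \<and> B n = unit_irrationals \<inter> (\<Inter>m. W m)" for n
  proof -
    have "B n \<in> Pi0 (top_of_set unit_irrationals) (Suc (Suc 0))" using ran \<C>(2) by blast
    then show ?thesis by (rule Pi0_2E) blast
  qed
  then obtain W :: "nat \<Rightarrow> nat \<Rightarrow> real set"
    where W: "\<And>n m. open (W n m)" "\<And>n. B n = unit_irrationals \<inter> (\<Inter>m. W n m)" by metis
  define V where "V n m = {\<alpha>. reduction z \<alpha> \<in> W n m}" for n m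
  have "\<exists>l. \<forall>\<beta>. agree l \<alpha> \<beta> \<longrightarrow> \<beta> \<in> V n m" if "\<alpha> \<in> V n m" for n m \<alpha>
  proof -
    have "reduction z \<alpha> \<in> W n m" using that by (simp add: V_def)
    then obtain e where e: "0 < e" "\<And>y. dist y (reduction z \<alpha>) < e \<Longrightarrow> y \<in> W n m"
      using W(1) unfolding open_dist by blast
    obtain k where k: "(1/4::real) ^ k < e" using real_arch_pow_inv[OF e(1), of "1/4"] by auto
    have "\<beta> \<in> V n m" if "agree (2 * k) \<alpha> \<beta>" for \<beta>
    proof -
      have "\<bar>reduction z \<beta> - reduction z \<alpha>\<bar> \<le> (1/4) ^ k"
        using that by (intro reduction_close z(2)) (simp add: agree_def)
      then show ?thesis unfolding V_def using k by (auto intro!: e(2) simp: dist_real_def)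
    qed
    then show ?thesis by blast
  qed
  then have "{\<alpha>. filterlim \<alpha> at_top sequentially} \<noteq> (\<Union>n. \<Inter>m. V n m)"
    by (rule at_top_not_Sigma3)
  moreover have "filterlim \<alpha> at_top sequentially \<longleftrightarrow> (\<exists>n. \<forall>m. \<alpha> \<in> V n m)" for \<alpha>
  proof -
    have "filterlim \<alpha> at_top sequentially \<longleftrightarrow> (\<exists>n. reduction z \<alpha> \<in> B n)"
      unfolding red[symmetric] \<C>(3) ran[symmetric] by auto
    then show ?thesis unfolding W(2) V_def using irr by auto
  qed
  ultimately show False by (simp add: set_eq_iff)
qed

theorem corollary18:
  shows "Pi0_complete (top_of_set unit_irrationals) 3 {x \<in> unit_irrationals. cf_normal x}"
  unfolding Pi0_complete_def using cf_normal_in_Pi0_3 cf_normal_not_in_Sigma0_3 by blast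

end
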